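(* Let $H$ be a cointerval $d$-graph on vertex set $[n]$, let $I=I_H\subset R=k[x_1,\dots,x_n]$ be the associated cointerval ideal, and let $X_H$ be the homomorphism complex supporting its minimal resolution. Then, under the lexicographic ordering of the generators of $I$, the iterated mapping cone resolution of $I$ is supported on $X_H$.
   Context: $k$ is a field and $R=k[x_1,\dots,x_n]$ with its $\mathbb{Z}^n$-grading. Hypergraphs: a $d$-graph $H$ on vertex set $V(H)$ is a collection $E(H)$ of $d$-element subsets (edges) of $V(H)$. Its edge ideal $I_H$ is the squarefree monomial ideal generated by the monomials $x_{i_1}\cdots x_{i_d}$ with $\{i_1,\dots,i_d\}\in E(H)$. For $v\in V(H)\subseteq\mathbb{Z}$, the $v$-layer of $H$ is the $(d-1)$-graph on $V(H)\setminus v$ with edge set $\{v_1\cdots v_{d-1} : vv_1\cdots v_{d-1}\in E(H),\ v<v_1,\dots,v_{d-1}\}$. Cointerval: any $1$-graph is cointerval. For $d>1$, a finite $d$-graph $H$ with $V(H)\subseteq\mathbb{Z}$ is cointerval if (1) for every $i\in V(H)$ the $i$-layer of $H$ is cointerval, and (2) for every pair $i<j$ of vertices the $j$-layer of $H$ is a subgraph of the $i$-layer of $H$ (every edge of the $j$-layer is an edge of the $i$-layer). The ideal $I_H$ is then called a cointerval ideal. It is known that a cointerval ideal has linear quotients with respect to the lexicographic order on its generators. Homomorphism complex: for subsets $\sigma,\tau\subset[n]$ write $\sigma<\tau$ if $x<y$ for all $x\in\sigma$, $y\in\tau$. The polyhedral complex $X_H$ is the subcomplex of the product $\prod_{i=1}^d\Delta_{V(H)}$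 of simplices on the vertex set $V(H)$ such that (1) its vertices are $v_{i_1}\times\cdots\times v_{i_d}$ with $v_{i_1}\cdots v_{i_d}$ an edge of $H$, and (2) its cells $\sigma_1\times\cdots\times\sigma_d$ (with nonempty $\sigma_i\subseteq V(H)$) satisfy $\sigma_1<\sigma_2<\cdots<\sigma_d$. So a product is a cell when (2) holds and all its vertices are vertices of $X_H$. A cell $\sigma_1\times\cdots\times\sigma_d$ is labeled by the monomial $\prod_{i=1}^d\prod_{j\in\sigma_i}x_j$, which is the least common multiple of the labels of its vertices. It is known that $X_H$ supports a minimal cellular resolution of $I_H$. Iterated mapping cone: let $(m_1,\dots,m_k)$ be the generators of $I$ in lexicographic order and $I_j=\langle m_1,\dots,m_j\rangle$. For each $j$ there is an exact sequence $0\to R/(I_{j-1}:m_j)\to R/I_{j-1}\to R/I_j\to0$, the first map being multiplication by $m_j$ (with the appropriate degree shift). Given the resolution $F$ of $R/I_{j-1}$ already constructed and the Koszul complex $G$ resolving $R/(I_{j-1}:m_j)$, one chooses a homomorphism of complexes $\psi:G\to F$ lifting the first map. The mapping cone $C(\psi)=G[1]\oplus F$, with differential $d(g,f)=(-d_G(g),\psi(g)+d_F(f))$, resolves $R/I_j$. The result depends on the choices of $\psi$, and the assertion is for a suitable choice of the lifts. A free resolution is supported on a labeled polyhedral complex $X$ if it is the $\mathbb{Z}^n$-graded complex obtained by homogenizing the (augmented) cellular chain complex of $X$. That is, cells of dimension $i-1$ form a basis of the $i$-th free module, and the coefficient of a cell $c'$ in the differential of a cell $c$ is the incidence number times the quotient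 of the label of $c$ by the label of $c'$. *)

theory Defs
  imports "HOL-Library.Poly_Mapping" "HOL-Algebra.Ideal"
begin

section \<open>Hypergraphs\<close>

definition d_graph :: "nat \<Rightarrow> 'a set \<Rightarrow> 'a set set \<Rightarrow> bool" where
  "d_graph d V E \<longleftrightarrow> finite V \<and> (\<forall>e\<in>E. e \<subseteq> V \<and> card e = d)"

definition layer :: "'a::linorder \<Rightarrow> 'a set set \<Rightarrow> 'a set set" where
  "layer v E = {f. (\<forall>w\<in>f. v < w) \<and> insert v f \<in> E}"

text \<open>
  In the recursion, the layer of a vertex \<open>i\<close> has as vertices those vertices of the graph that
  are larger than \<open>i\<close>; all its edges live there.  If the smaller vertices were kept as (isolated)
  vertices of the layer, the inclusion condition would force its layers at larger vertices to be
  empty, and already the complete 3-graph on four vertices would fail to be cointerval.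
  The predicate that keeps them is \<open>cointerval_all\<close> below.  By \<open>cointerval_all_imp_cointerval\<close>
  it implies \<open>cointerval\<close>, so a statement about all cointerval graphs covers both readings.
\<close>
fun cointerval :: "nat \<Rightarrow> 'a::linorder set \<Rightarrow> 'a set set \<Rightarrow> bool" where
  "cointerval 0 V E \<longleftrightarrow> False"
| "cointerval (Suc 0) V E \<longleftrightarrow> True"
| "cointerval (Suc (Suc d)) V E \<longleftrightarrow>
     (\<forall>i\<in>V. cointerval (Suc d) {w \<in> V. i < w} (layer i E)) \<and>
     (\<forall>i\<in>V. \<forall>j\<in>V. i < j \<longrightarrow> layer j E \<subseteq> layer i E)"

fun cointerval_all :: "nat \<Rightarrow> 'a::linorder set \<Rightarrow> 'a set set \<Rightarrow> bool" where
  "cointerval_all 0 V E \<longleftrightarrow> False"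
| "cointerval_all (Suc 0) V E \<longleftrightarrow> True"
| "cointerval_all (Suc (Suc d)) V E \<longleftrightarrow>
     (\<forall>i\<in>V. cointerval_all (Suc d) (V - {i}) (layer i E)) \<and>
     (\<forall>i\<in>V. \<forall>j\<in>V. i < j \<longrightarrow> layer j E \<subseteq> layer i E)"

lemma cointerval_all_mono:
  "cointerval_all d V E \<Longrightarrow> W \<subseteq> V \<Longrightarrow> cointerval d W E"
proof (induction d V E arbitrary: W rule: cointerval_all.induct)
  case (3 d V E)
  have "cointerval (Suc d) {w \<in> W. i < w} (layer i E)" if "i \<in> W" for i
    using that 3 by (intro "3.IH"[of i]) auto
  moreover have "layer j E \<subseteq> layer i E" if "i \<in> W" "j \<in> W" "i < j" for i j
    using that "3.prems" by (meson cointerval_all.simps(3) subsetD)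
  ultimately show ?case by simp
qed auto

lemma cointerval_all_imp_cointerval: "cointerval_all d V E \<Longrightarrow> cointerval d V E"
  using cointerval_all_mono by blast


section \<open>Polynomials in the variables 1 to n, and monomial ideals\<close>

type_synonym mon = "nat \<Rightarrow>\<^sub>0 nat"
type_synonym 'k poly = "mon \<Rightarrow>\<^sub>0 'k"

definition x_mon :: "nat set \<Rightarrow> mon" where
  "x_mon s = (\<Sum>i\<in>s. Poly_Mapping.single i 1)"

definition monomial :: "mon \<Rightarrow> 'k::field poly" where
  "monomial m = Poly_Mapping.single m 1"

text \<open>The operations are those of the type class, restricted to the variables 1 to n.\<close>
definition polys :: "nat \<Rightarrow> 'k::field poly ring" where
  "polys n = \<lparr>carrier = {p. \<forall>m\<in>Poly_Mapping.keys p. Poly_Mapping.keys m \<subseteq> {1..n}},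
     mult = (*), one = 1, zero = 0, add = (+)\<rparr>"

definition edge_ideal :: "nat \<Rightarrow> nat set set \<Rightarrow> 'k::field poly set" where
  "edge_ideal n E = Idl\<^bsub>polys n\<^esub> ((\<lambda>e. monomial (x_mon e)) ` E)"

definition var_ideal :: "nat \<Rightarrow> nat set \<Rightarrow> 'k::field poly set" where
  "var_ideal n S = Idl\<^bsub>polys n\<^esub> ((\<lambda>s. monomial (x_mon {s})) ` S)"

definition colon :: "nat \<Rightarrow> 'k::field poly set \<Rightarrow> 'k poly \<Rightarrow> 'k poly set" where
  "colon n I p = {f \<in> carrier (polys n). f * p \<in> I}"


section \<open>Complexes of multigraded free modules with bases\<close>

text \<open>
  \<open>basis F i\<close> is a homogeneous basis of the \<open>i\<close>-th free module, with multidegrees \<open>mdeg\<close>.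
  The differential sends \<open>b \<in> basis F (Suc i)\<close> to the sum of \<open>bd F b b' \<cdot> b'\<close> over
  \<open>b' \<in> basis F i\<close>; values of \<open>bd F\<close> at other pairs carry no meaning.
  All multidegrees that occur are nonnegative, so exponent vectors suffice.
\<close>
record (overloaded) ('b, 'k::zero) free_complex =
  basis :: "nat \<Rightarrow> 'b set"
  mdeg :: "'b \<Rightarrow> mon"
  bd :: "'b \<Rightarrow> 'b \<Rightarrow> 'k poly"

definition shift :: "mon \<Rightarrow> ('b, 'k::field) free_complex \<Rightarrow> ('b, 'k) free_complex" where
  "shift m F = F\<lparr>mdeg := \<lambda>b. m + mdeg F b\<rparr>"

text \<open>The Koszul complex on the variables with index in \<open>S\<close>, taken in increasing order.\<close>
definition koszul :: "nat set \<Rightarrow> (nat set, 'k::field) free_complex" where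
  "koszul S = \<lparr>basis = (\<lambda>i. {T. T \<subseteq> S \<and> finite T \<and> card T = i}),
     mdeg = x_mon,
     bd = (\<lambda>T T'. \<Sum>t\<in>T. if T' = T - {t} then (-1) ^ card {s\<in>T. s < t} * monomial (x_mon {t}) else 0)\<rparr>"

text \<open>
  Multigraded homomorphisms of complexes \<open>G \<rightarrow> F\<close>, given by their matrices: \<open>\<psi> g f\<close> is the
  coefficient of \<open>f \<in> basis F i\<close> in the image of \<open>g \<in> basis G i\<close>.
\<close>
definition chain_map :: "nat \<Rightarrow> ('g, 'k::field) free_complex \<Rightarrow> ('f, 'k) free_complex \<Rightarrow>
    ('g \<Rightarrow> 'f \<Rightarrow> 'k poly) \<Rightarrow> bool" where
  "chain_map n G F \<psi> \<longleftrightarrow>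
     (\<forall>i. \<forall>g\<in>basis G i. \<forall>f\<in>basis F i. \<psi> g f \<in> carrier (polys n) \<and>
        (\<forall>m\<in>Poly_Mapping.keys (\<psi> g f). m + mdeg F f = mdeg G g)) \<and>
     (\<forall>i. \<forall>g\<in>basis G (Suc i). \<forall>f\<in>basis F i.
        (\<Sum>g'\<in>basis G i. bd G g g' * \<psi> g' f) = (\<Sum>f'\<in>basis F (Suc i). \<psi> g f' * bd F f' f))"

text \<open>The cone \<open>G[1] \<oplus> F\<close> with \<open>d (g, f) = (- d\<^sub>G g, \<psi> g + d\<^sub>F f)\<close>.\<close>
definition mapping_cone :: "('g, 'k::field) free_complex \<Rightarrow> ('f, 'k) free_complex \<Rightarrow>
    ('g \<Rightarrow> 'f \<Rightarrow> 'k poly) \<Rightarrow> ('g + 'f, 'k) free_complex" where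
  "mapping_cone G F \<psi> = \<lparr>
     basis = (\<lambda>i. (case i of 0 \<Rightarrow> {} | Suc j \<Rightarrow> Inl ` basis G j) \<union> Inr ` basis F i),
     mdeg = (\<lambda>b. case b of Inl g \<Rightarrow> mdeg G g | Inr f \<Rightarrow> mdeg F f),
     bd = (\<lambda>b b'. case (b, b') of
        (Inl g, Inl g') \<Rightarrow> - bd G g g'
      | (Inl g, Inr f) \<Rightarrow> \<psi> g f
      | (Inr f, Inl g) \<Rightarrow> 0
      | (Inr f, Inr f') \<Rightarrow> bd F f f')\<rparr>"


section \<open>Iterated mapping cones along a list of squarefree generators\<close>

text \<open>
  To keep one type for all stages, the basis of the ring in homological degree 0 is \<open>None\<close>, and
  the basis element \<open>T\<close> of the Koszul complex attached for the generator of an edge \<open>e\<close> is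
  renamed to \<open>Some (e, T)\<close>.
\<close>
type_synonym cone_basis = "(nat set \<times> nat set) option"

definition untag :: "nat set \<Rightarrow> cone_basis \<Rightarrow> nat set + cone_basis" where
  "untag e b = (case b of None \<Rightarrow> Inr None
     | Some (e', T) \<Rightarrow> if e' = e then Inl T else Inr (Some (e', T)))"

definition relabel :: "('c \<Rightarrow> 'b) \<Rightarrow> ('b, 'k::field) free_complex \<Rightarrow> ('c, 'k) free_complex" where
  "relabel u F = \<lparr>basis = (\<lambda>i. {c. u c \<in> basis F i}), mdeg = (\<lambda>c. mdeg F (u c)),
     bd = (\<lambda>c c'. bd F (u c) (u c'))\<rparr>"

definition ring_complex :: "(cone_basis, 'k::field) free_complex" where
  "ring_complex = \<lparr>basis = (\<lambda>i. if i = 0 then {None} else {}), mdeg = (\<lambda>_. 0), bd = (\<lambda>_ _. 0)\<rparr>"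

text \<open>
  One step: \<open>I\<close> is generated by the monomials of the edges \<open>es\<close>, \<open>F\<close> is the complex built for
  \<open>R/I\<close>, and the colon ideal of \<open>I\<close> by the next generator is generated by the variables in \<open>S\<close>.
  The last premise says that \<open>\<psi>\<close> lifts the multiplication map by that generator
  from \<open>R/(I : x\<^sup>e)\<close> to \<open>R/I\<close>.
\<close>
inductive iterated_cone :: "nat \<Rightarrow> nat set list \<Rightarrow> (cone_basis, 'k::field) free_complex \<Rightarrow> bool"
  for n where
  Nil: "iterated_cone n [] ring_complex"
| snoc: "iterated_cone n es F \<Longrightarrow>
    S \<subseteq> {1..n} \<Longrightarrow>
    colon n (edge_ideal n (set es)) (monomial (x_mon e)) = (var_ideal n S :: 'k poly set) \<Longrightarrow>
    G = shift (x_mon e) (koszul S) \<Longrightarrow>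
    chain_map n G F \<psi> \<Longrightarrow>
    \<psi> {} None - monomial (x_mon e) \<in> edge_ideal n (set es) \<Longrightarrow>
    iterated_cone n (es @ [e]) (relabel (untag e) (mapping_cone G F \<psi>))"

text \<open>
  The library order on exponent vectors compares the first differing exponent, so it is the
  lexicographic order with \<open>x\<^sub>1 > x\<^sub>2 > \<dots>\<close>; generators are listed from the largest on, i.e. edges,
  written as increasing words, in dictionary order.
\<close>
definition lex_list :: "nat set set \<Rightarrow> nat set list \<Rightarrow> bool" where
  "lex_list E es \<longleftrightarrow> set es = E \<and> sorted_wrt (\<lambda>e f. x_mon e > x_mon f) es"

definition lex_iterated_mapping_cone ::
    "nat \<Rightarrow> nat set set \<Rightarrow> (cone_basis, 'k::field) free_complex \<Rightarrow> bool" where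
  "lex_iterated_mapping_cone n E F \<longleftrightarrow> (\<exists>es. lex_list E es \<and> iterated_cone n es F)"


section \<open>Cellular complexes\<close>

text \<open>\<open>cells\<close> are the nonempty cells, \<open>incidence\<close> the incidence numbers of a fixed orientation.\<close>
record 'c labeled_complex =
  cells :: "'c set"
  cdim :: "'c \<Rightarrow> nat"
  incidence :: "'c \<Rightarrow> 'c \<Rightarrow> int"
  label :: "'c \<Rightarrow> mon"

text \<open>The homogenized augmented cellular chain complex; \<open>None\<close> is the empty cell.\<close>
definition cellular_complex :: "'c labeled_complex \<Rightarrow> ('c option, 'k::field) free_complex" where
  "cellular_complex X = \<lparr>
     basis = (\<lambda>i. case i of 0 \<Rightarrow> {None} | Suc j \<Rightarrow> Some ` {c \<in> cells X. cdim X c = j}),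
     mdeg = (\<lambda>b. case b of None \<Rightarrow> 0 | Some c \<Rightarrow> label X c),
     bd = (\<lambda>b b'. case (b, b') of
        (Some c, Some c') \<Rightarrow> Poly_Mapping.single (label X c - label X c') (of_int (incidence X c c'))
      | (Some c, None) \<Rightarrow> monomial (label X c)
      | (None, _) \<Rightarrow> 0)\<rparr>"

text \<open>Change of orientation of the cells of positive dimension.\<close>
definition orientation_change :: "'c labeled_complex \<Rightarrow> ('c \<Rightarrow> int) \<Rightarrow> bool" where
  "orientation_change X \<epsilon> \<longleftrightarrow> (\<forall>c\<in>cells X. \<epsilon> c \<in> {1, -1} \<and> (cdim X c = 0 \<longrightarrow> \<epsilon> c = 1))"

definition reorient :: "('c \<Rightarrow> int) \<Rightarrow> 'c labeled_complex \<Rightarrow> 'c labeled_complex" where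
  "reorient \<epsilon> X = X\<lparr>incidence := \<lambda>c c'. \<epsilon> c * \<epsilon> c' * incidence X c c'\<rparr>"

text \<open>
  The given basis of \<open>F\<close> itself is identified with the cells (not just some basis of an isomorphic
  complex); only the orientation of the cells is free.
\<close>
definition supported_on :: "('b, 'k::field) free_complex \<Rightarrow> 'c labeled_complex \<Rightarrow> bool" where
  "supported_on F X \<longleftrightarrow> (\<exists>\<epsilon> \<beta>. orientation_change X \<epsilon> \<and>
     (let C = (cellular_complex (reorient \<epsilon> X) :: ('c option, 'k) free_complex) in
       (\<forall>i. bij_betw \<beta> (basis F i) (basis C i)) \<and>
       (\<forall>i. \<forall>b\<in>basis F i. mdeg F b = mdeg C (\<beta> b)) \<and>
       (\<forall>i. \<forall>b\<in>basis F (Suc i). \<forall>b'\<in>basis F i. bd F b b' = bd C (\<beta> b) (\<beta> b'))))"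


section \<open>The homomorphism complex\<close>

text \<open>
  A cell \<open>\<sigma>\<^sub>1 \<times> \<dots> \<times> \<sigma>\<^sub>d\<close> is the list of its factors.  Its vertices are given by the lists \<open>w\<close>
  with \<open>w ! i \<in> \<sigma> ! i\<close>.
\<close>
definition hom_cells :: "nat \<Rightarrow> nat \<Rightarrow> nat set set \<Rightarrow> nat set list set" where
  "hom_cells d n E = {\<sigma>. length \<sigma> = d \<and>
     (\<forall>s\<in>set \<sigma>. s \<noteq> {} \<and> s \<subseteq> {1..n}) \<and>
     sorted_wrt (\<lambda>s t. \<forall>x\<in>s. \<forall>y\<in>t. x < y) \<sigma> \<and>
     (\<forall>w. list_all2 (\<in>) w \<sigma> \<longrightarrow> set w \<in> E)}"

text \<open>
  Incidence numbers of the product orientation: the boundary of a product is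
  \<open>\<Sum>\<^sub>i (-1)\<^bsup>dim \<sigma>\<^sub>1 + \<dots> + dim \<sigma>\<^sub>i\<^sub>-\<^sub>1\<^esup> \<sigma>\<^sub>1 \<times> \<dots> \<times> \<partial>\<sigma>\<^sub>i \<times> \<dots> \<times> \<sigma>\<^sub>d\<close>, every simplex being oriented
  by the increasing order of its vertices.
\<close>
definition product_incidence :: "nat set list \<Rightarrow> nat set list \<Rightarrow> int" where
  "product_incidence \<sigma> \<tau> = (\<Sum>i<length \<sigma>. \<Sum>x\<in>\<sigma> ! i.
     if \<tau> = \<sigma>[i := \<sigma> ! i - {x}]
     then (-1) ^ ((\<Sum>l<i. card (\<sigma> ! l) - 1) + card {y \<in> \<sigma> ! i. y < x}) else 0)"

definition hom_complex :: "nat \<Rightarrow> nat \<Rightarrow> nat set set \<Rightarrow> nat set list labeled_complex" where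
  "hom_complex d n E = \<lparr>cells = hom_cells d n E,
     cdim = (\<lambda>\<sigma>. \<Sum>s\<leftarrow>\<sigma>. card s - 1),
     incidence = product_incidence,
     label = (\<lambda>\<sigma>. \<Sum>s\<leftarrow>\<sigma>. x_mon s)\<rparr>"

end

theory Submission
  imports Defs
begin

text \<open>
  Call the \<open>exchange_set\<close> of an edge \<open>e\<close> the set of vertices \<open>s \<notin> e\<close> below the largest vertex of \<open>e\<close> that
  can replace the next larger vertex of \<open>e\<close>.  Cointerval graphs are closed under decreasing all
  vertices of an edge except the last one, so such replacements can be made independently of each
  other.  Hence the cells of the homomorphism complex whose lexicographically last vertex is \<open>e\<close>
  are exactly the products \<open>cell e T\<close> obtained from \<open>e\<close> by adding a subset \<open>T\<close> of the exchange set to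
  its factors, and the exchange set generates the colon ideal of the step that adds \<open>e\<close>.

  The incidence numbers between the cells \<open>cell e T\<close> agree with the Koszul signs; reversing the
  orientation of all cells of odd dimension yields the sign of the shifted complex.  The part of the
  cellular differential that leads from these cells to those of earlier edges is then a chain
  map, because the cellular differential squares to zero, and it is the required lift.
\<close>

section \<open>Monomial ideals\<close>

text \<open>The condition on layers says nothing about 1-graphs, so the last vertex of an edge
  cannot be lowered freely. This shapes every argument about edges: the last vertex is handled
  through an edge that is already known, the other vertices by passing to larger layers. It is also
  why the exchange set asks for membership in \<open>E\<close> instead of being a union of
  intervals.

  The induction runs through the prefixes of the lexicographic list, while exchanges are always
  formed in the whole graph. The two fit together because an exchange comes earlier in the list than
  \<open>e\<close>, so it lies in each prefix that contains \<open>e\<close>.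

  In an ordered product, deleting a vertex has the sign it would have in the simplex on all
  vertices, corrected by the number of factors below it. In \<open>cell e T\<close> the factors
  below \<open>t\<close> match the vertices of \<open>e\<close> below \<open>t\<close>, so only the
  elements of \<open>T\<close> are left to count. Reorienting by the parity of the dimension
  reverses each incidence between consecutive dimensions but fixes the vertices, hence the
  augmentation.\<close>

lemma lookup_x_mon:
  "finite s \<Longrightarrow> Poly_Mapping.lookup (x_mon s) i = (if i \<in> s then 1 else 0)"
  by (simp add: x_mon_def lookup_sum lookup_single when_def)

lemma keys_x_mon: "finite s \<Longrightarrow> Poly_Mapping.keys (x_mon s) = s"
  by (auto simp: in_keys_iff lookup_x_mon split: if_splits)

lemma x_mon_empty [simp]: "x_mon {} = 0"
  by (simp add: x_mon_def)

lemma x_mon_Un_disjoint: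
  "finite s \<Longrightarrow> finite t \<Longrightarrow> s \<inter> t = {} \<Longrightarrow> x_mon (s \<union> t) = x_mon s + x_mon t"
  by (simp add: x_mon_def sum.union_disjoint)

lemma keys_plus_mon:
  "Poly_Mapping.keys (a + b :: mon) = Poly_Mapping.keys a \<union> Poly_Mapping.keys b"
  by (auto simp: in_keys_iff lookup_add)

text \<open>Subtraction of exponent vectors truncates at 0, so divisibility is expressed by the fact
  that adding \<open>x_mon e\<close> back restores \<open>m\<close>.\<close>

lemma x_mon_dvd:
  assumes "finite e" "e \<subseteq> Poly_Mapping.keys m"
  shows "m - x_mon e + x_mon e = m"
proof (rule poly_mapping_eqI)
  fix i
  have "Poly_Mapping.lookup m i \<noteq> 0" if "i \<in> e"
    using assms that by (auto simp: in_keys_iff)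
  then show "Poly_Mapping.lookup (m - x_mon e + x_mon e) i = Poly_Mapping.lookup m i"
    using assms by (auto simp: lookup_add lookup_minus lookup_x_mon)
qed

text \<open>For 0-1 vectors the first index where they differ decides, so exchanging a vertex for a
  smaller one makes the monomial larger.\<close>

lemma x_mon_less_iff:
  assumes "finite e" "finite f"
  shows "x_mon e < x_mon f \<longleftrightarrow> (\<exists>k. k \<in> f \<and> k \<notin> e \<and> (\<forall>j<k. j \<in> e \<longleftrightarrow> j \<in> f))"
  unfolding less_poly_mapping.rep_eq less_fun_def using assms
  by (auto simp: lookup_x_mon split: if_splits)

lemma sum_single_lookup:
  "(\<Sum>k\<in>Poly_Mapping.keys p. Poly_Mapping.single k (Poly_Mapping.lookup p k)) = p"
  by (rule poly_mapping_eqI) (auto simp: lookup_sum lookup_single when_def in_keys_iff)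

lemma lookup_mult_monomial:
  "Poly_Mapping.lookup (p * monomial e) (m + e) = Poly_Mapping.lookup (p :: 'k::field poly) m"
proof -
  have *: "p * monomial e = (\<Sum>k\<in>Poly_Mapping.keys p. Poly_Mapping.single (k + e) (Poly_Mapping.lookup p k))"
  proof -
    have "p * monomial e = (\<Sum>k\<in>Poly_Mapping.keys p. Poly_Mapping.single k (Poly_Mapping.lookup p k)) * monomial e"
      by (simp only: sum_single_lookup)
    then show ?thesis
      by (simp add: sum_distrib_right mult_single monomial_def)
  qed
  show ?thesis
    unfolding * by (auto simp: lookup_sum lookup_single when_def in_keys_iff)
qed

text \<open>Multiplication by a monomial translates the support injectively, so no terms cancel;
  \<open>keys_mult\<close> alone gives just one inclusion.\<close>

lemma keys_mult_monomial:
  "Poly_Mapping.keys (p * monomial e :: 'k::field poly) = (\<lambda>m. m + e) ` Poly_Mapping.keys p"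
proof
  have "Poly_Mapping.keys (p * monomial e) \<subseteq> {a + b | a b. a \<in> Poly_Mapping.keys p \<and> b \<in> {e}}"
    using keys_mult[of p "monomial e"] by (auto simp: monomial_def)
  then show "Poly_Mapping.keys (p * monomial e) \<subseteq> (\<lambda>m. m + e) ` Poly_Mapping.keys p"
    by blast
qed (auto simp: in_keys_iff lookup_mult_monomial)

lemma ring_polys: "ring (polys n :: 'k::field poly ring)"
proof (intro ringI abelian_groupI monoidI)
  fix x y :: "'k poly"
  assume xy: "x \<in> carrier (polys n)" "y \<in> carrier (polys n)"
  then show "x \<oplus>\<^bsub>polys n\<^esub> y \<in> carrier (polys n)"
    using keys_add[of x y] by (auto simp: polys_def)
  have "Poly_Mapping.keys m \<subseteq> {1..n}" if "m \<in> Poly_Mapping.keys (x * y)" for m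
  proof -
    from that obtain a b where "m = a + b" "a \<in> Poly_Mapping.keys x" "b \<in> Poly_Mapping.keys y"
      using keys_mult[of x y] by blast
    then show ?thesis
      using xy by (simp add: polys_def keys_plus_mon)
  qed
  then show "x \<otimes>\<^bsub>polys n\<^esub> y \<in> carrier (polys n)"
    by (simp add: polys_def)
next
  fix x :: "'k poly"
  assume "x \<in> carrier (polys n)"
  then show "\<exists>y\<in>carrier (polys n). y \<oplus>\<^bsub>polys n\<^esub> x = \<zero>\<^bsub>polys n\<^esub>"
    by (intro bexI[of _ "- x"]) (auto simp: polys_def)
qed (auto simp: polys_def algebra_simps)

text \<open>Membership in a monomial ideal is tested term by term, which turns the colon ideal into
  a question about supports. The right-hand side is an ideal containing the generators; conversely
  each term of \<open>p\<close> is a multiple of a generator, so \<open>p\<close> lies in every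
  ideal that contains them.\<close>

lemma monomial_Idl_eq:
  assumes "\<And>e. e \<in> M \<Longrightarrow> finite e \<and> e \<subseteq> {1..n}"
  shows "Idl\<^bsub>polys n\<^esub> ((\<lambda>e. monomial (x_mon e)) ` M) =
    {p :: 'k::field poly. \<forall>m\<in>Poly_Mapping.keys p.
       Poly_Mapping.keys m \<subseteq> {1..n} \<and> (\<exists>e\<in>M. e \<subseteq> Poly_Mapping.keys m)}" (is "_ = ?J")
proof -
  interpret ring "polys n :: 'k poly ring" by (rule ring_polys)
  have gens: "(\<lambda>e. monomial (x_mon e)) ` M \<subseteq> ?J"
    using assms by (force simp: monomial_def keys_x_mon simp del: atLeastAtMost_iff)
  have J: "ideal ?J (polys n)"
  proof (intro idealI ring_polys)
    show "subgroup ?J (add_monoid (polys n))"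
    proof (intro add.subgroupI)
      fix x y assume "x \<in> ?J" "y \<in> ?J"
      then show "x \<oplus>\<^bsub>polys n\<^esub> y \<in> ?J"
        using keys_add[of x y] by (auto simp: polys_def)
    next
      fix x assume x: "x \<in> ?J"
      then have "\<ominus>\<^bsub>polys n\<^esub> x = - x"
        by (intro minus_equality) (auto simp: polys_def)
      with x show "\<ominus>\<^bsub>polys n\<^esub> x \<in> ?J"
        by auto
    next
      have "0 \<in> ?J" by simp
      then show "?J \<noteq> {}" by blast
    qed (auto simp: polys_def)
  next
    fix a x :: "'k poly" assume a: "a \<in> ?J" and x: "x \<in> carrier (polys n)"
    have "a * x \<in> ?J"
    proof (intro CollectI ballI)
      fix m assume "m \<in> Poly_Mapping.keys (a * x)"
      then obtain b c where "m = b + c" "b \<in> Poly_Mapping.keys a" "c \<in> Poly_Mapping.keys x"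
        using keys_mult[of a x] by blast
      moreover from this have "Poly_Mapping.keys b \<subseteq> {1..n}" "Poly_Mapping.keys c \<subseteq> {1..n}"
        "\<exists>e\<in>M. e \<subseteq> Poly_Mapping.keys b"
        using a x unfolding polys_def by auto
      ultimately show "Poly_Mapping.keys m \<subseteq> {1..n} \<and> (\<exists>e\<in>M. e \<subseteq> Poly_Mapping.keys m)"
        unfolding \<open>m = b + c\<close> keys_plus_mon by blast
    qed
    then show "x \<otimes>\<^bsub>polys n\<^esub> a \<in> ?J" "a \<otimes>\<^bsub>polys n\<^esub> x \<in> ?J"
      by (simp_all add: polys_def mult.commute)
  qed
  have "p \<in> I" if p: "p \<in> ?J" and I: "ideal I (polys n)"
    and sub: "(\<lambda>e. monomial (x_mon e)) ` M \<subseteq> I" for p I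
  proof -
    interpret I: ideal I "polys n" by (rule I)
    have closed: "a + b \<in> I" if "a \<in> I" "b \<in> I" for a b
      using I.a_closed[OF that] by (simp add: polys_def)
    have zero: "0 \<in> I"
      using I.zero_closed by (simp add: polys_def)
    have terms: "Poly_Mapping.single m (Poly_Mapping.lookup p m) \<in> I" if "m \<in> Poly_Mapping.keys p" for m
    proof -
      from p that obtain e where e: "e \<in> M" "e \<subseteq> Poly_Mapping.keys m" and m: "Poly_Mapping.keys m \<subseteq> {1..n}"
        by blast
      then have "finite e" using assms by blast
      let ?q = "Poly_Mapping.single (m - x_mon e) (Poly_Mapping.lookup p m)"
      have "m - x_mon e + x_mon e = m"
        using x_mon_dvd \<open>finite e\<close> e by blast
      moreover from this have "?q \<in> carrier (polys n)"
        using m keys_plus_mon[of "m - x_mon e" "x_mon e"] by (simp add: polys_def)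
      moreover have "monomial (x_mon e) \<in> I" using sub e by blast
      ultimately show ?thesis
        using I.I_l_closed[of "monomial (x_mon e)" ?q] by (simp add: polys_def monomial_def mult_single)
    qed
    have "(\<Sum>m\<in>K. Poly_Mapping.single m (Poly_Mapping.lookup p m)) \<in> I"
      if "finite K" "K \<subseteq> Poly_Mapping.keys p" for K
      using that by (induction K rule: finite_induct) (simp_all add: terms closed zero)
    from this[OF finite_keys] have "(\<Sum>m\<in>Poly_Mapping.keys p. Poly_Mapping.single m (Poly_Mapping.lookup p m)) \<in> I"
      by blast
    then show ?thesis by (simp only: sum_single_lookup)
  qed
  then have "?J \<subseteq> Idl\<^bsub>polys n\<^esub> ((\<lambda>e. monomial (x_mon e)) ` M)"
    unfolding genideal_def by blast
  moreover have "Idl\<^bsub>polys n\<^esub> ((\<lambda>e. monomial (x_mon e)) ` M) \<subseteq> ?J"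
    using genideal_minimal[OF J gens] .
  ultimately show ?thesis by blast
qed

section \<open>The cellular chain complex of a complex of ordered products\<close>

text \<open>The edge set is left out because labels, dimensions and signs depend only on the factors
  and their order.\<close>

definition blocks :: "nat set list \<Rightarrow> bool" where
  "blocks \<sigma> \<longleftrightarrow> (\<forall>s\<in>set \<sigma>. finite s \<and> s \<noteq> {}) \<and>
     sorted_wrt (\<lambda>s t. \<forall>x\<in>s. \<forall>y\<in>t. x < y) \<sigma>"

text \<open>The factors of an ordered product are disjoint, so deleting \<open>x\<close> from all of
  them changes at most one. Facets are thus indexed by elements of the union, without naming a
  factor, and two deletions commute.\<close>

definition del :: "nat \<Rightarrow> nat set list \<Rightarrow> nat set list" where
  "del x \<sigma> = map (\<lambda>s. s - {x}) \<sigma>"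

lemma length_del [simp]: "length (del x \<sigma>) = length \<sigma>"
  by (simp add: del_def)

lemma nth_del [simp]: "i < length \<sigma> \<Longrightarrow> del x \<sigma> ! i = \<sigma> ! i - {x}"
  by (simp add: del_def)

lemma Union_del: "\<Union>(set (del x \<sigma>)) = \<Union>(set \<sigma>) - {x}"
  by (auto simp: del_def)

lemma del_inject:
  assumes "x \<in> \<Union>(set \<sigma>)" "y \<in> \<Union>(set \<sigma>)"
  shows "del x \<sigma> = del y \<sigma> \<longleftrightarrow> x = y"
proof
  assume "del x \<sigma> = del y \<sigma>"
  then have "\<Union>(set \<sigma>) - {x} = \<Union>(set \<sigma>) - {y}"
    by (simp only: Union_del[symmetric])
  with assms show "x = y" by blast
qed simp

lemma del_commute: "del x (del y \<sigma>) = del y (del x \<sigma>)"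
  by (auto simp: del_def)

lemma blocks_Cons:
  "blocks (s # \<sigma>) \<longleftrightarrow> finite s \<and> s \<noteq> {} \<and> (\<forall>t\<in>set \<sigma>. \<forall>x\<in>s. \<forall>y\<in>t. x < y) \<and> blocks \<sigma>"
  by (auto simp: blocks_def)

lemma finite_Union_blocks: "blocks \<sigma> \<Longrightarrow> finite (\<Union>(set \<sigma>))"
  by (auto simp: blocks_def)

lemma blocks_less:
  "blocks \<sigma> \<Longrightarrow> i < j \<Longrightarrow> j < length \<sigma> \<Longrightarrow> x \<in> \<sigma> ! i \<Longrightarrow> y \<in> \<sigma> ! j \<Longrightarrow> x < y"
  unfolding blocks_def sorted_wrt_iff_nth_less by blast

lemma blocks_index_unique:
  "blocks \<sigma> \<Longrightarrow> i < length \<sigma> \<Longrightarrow> j < length \<sigma> \<Longrightarrow> x \<in> \<sigma> ! i \<Longrightarrow> x \<in> \<sigma> ! j \<Longrightarrow> i = j"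
  by (metis blocks_less less_irrefl nat_neq_iff)

lemma blocks_disjoint_hd:
  assumes "blocks (s # \<sigma>)" shows "s \<inter> \<Union>(set \<sigma>) = {}"
  using assms unfolding blocks_Cons by (meson UnionE disjoint_iff less_irrefl)

lemma blocks_card: "blocks \<sigma> \<Longrightarrow> card (\<Union>(set \<sigma>)) = (\<Sum>s\<leftarrow>\<sigma>. card s - 1) + length \<sigma>"
proof (induction \<sigma>)
  case (Cons s \<sigma>)
  then have *: "blocks \<sigma>" "finite s" "s \<noteq> {}" by (auto simp: blocks_Cons)
  then have "card s > 0" by (simp add: card_gt_0_iff)
  then show ?case
    using Cons.IH[OF *(1)] * blocks_disjoint_hd[OF Cons.prems] finite_Union_blocks[OF *(1)]
    by (simp add: card_Un_disjoint)
qed simp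

lemma blocks_x_mon: "blocks \<sigma> \<Longrightarrow> (\<Sum>s\<leftarrow>\<sigma>. x_mon s) = x_mon (\<Union>(set \<sigma>))"
proof (induction \<sigma>)
  case (Cons s \<sigma>)
  then have *: "blocks \<sigma>" "finite s" by (auto simp: blocks_Cons)
  then show ?case
    using Cons.IH[OF *(1)] blocks_disjoint_hd[OF Cons.prems] finite_Union_blocks[OF *(1)]
    by (simp add: x_mon_Un_disjoint)
qed simp

lemma blocks_update_eq_del:
  assumes "blocks \<sigma>" "i < length \<sigma>" "x \<in> \<sigma> ! i"
  shows "\<sigma>[i := \<sigma> ! i - {x}] = del x \<sigma>"
proof (rule nth_equalityI)
  fix j assume "j < length (\<sigma>[i := \<sigma> ! i - {x}])"
  then have j: "j < length \<sigma>" by simp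
  then have "x \<notin> \<sigma> ! j" if "j \<noteq> i"
    using blocks_index_unique[OF assms(1,2) j assms(3)] that by blast
  then show "\<sigma>[i := \<sigma> ! i - {x}] ! j = del x \<sigma> ! j"
    using j by (cases "j = i") simp_all
qed simp

text \<open>Recovers the position of the factor containing \<open>x\<close> as a count that mentions
  no index. Nonempty factors are essential here: an empty one would count as lying below
  everything.\<close>

lemma blocks_below_index:
  assumes "blocks \<sigma>" "i < length \<sigma>" "x \<in> \<sigma> ! i"
  shows "{l. l < length \<sigma> \<and> (\<forall>y\<in>\<sigma> ! l. y < x)} = {..<i}"
proof (intro Set.set_eqI iffI; clarsimp)
  fix l assume l: "l < length \<sigma>" "\<forall>y\<in>\<sigma> ! l. y < x"
  then obtain y where "y \<in> \<sigma> ! l"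
    using assms(1) by (metis blocks_def ex_in_conv nth_mem)
  have "\<not> i < l" "i \<noteq> l"
    using l assms \<open>y \<in> \<sigma> ! l\<close> blocks_less[OF assms(1), of i l x y] by auto
  then show "l < i" by simp
next
  fix l assume "l < i"
  then show "l < length \<sigma> \<and> (\<forall>y\<in>\<sigma> ! l. y < x)"
    using assms(2) blocks_less[OF assms(1) \<open>l < i\<close> assms(2) _ assms(3)] by simp
qed

section \<open>Signs of faces\<close>

text \<open>In the product orientation the exponent is the number of smaller vertices minus the
  number of earlier factors. Modulo 2 the difference may be written as a sum, which avoids truncated
  subtraction.\<close>

definition face_sign :: "nat set list \<Rightarrow> nat \<Rightarrow> int" where
  "face_sign \<sigma> x = (-1) ^ (card {y \<in> \<Union>(set \<sigma>). y < x} +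
     card {l. l < length \<sigma> \<and> (\<forall>y\<in>\<sigma> ! l. y < x)})"

lemma card_below:
  assumes "blocks \<sigma>" "i < length \<sigma>" "x \<in> \<sigma> ! i"
  shows "card {y \<in> \<Union>(set \<sigma>). y < x} = (\<Sum>l<i. card (\<sigma> ! l) - 1) + i + card {y \<in> \<sigma> ! i. y < x}"
proof -
  have fin: "finite (\<sigma> ! l)" "card (\<sigma> ! l) > 0" if "l < length \<sigma>" for l
    using assms(1) that by (auto simp: blocks_def card_gt_0_iff)
  have "{y \<in> \<Union>(set \<sigma>). y < x} = (\<Union>l<i. \<sigma> ! l) \<union> {y \<in> \<sigma> ! i. y < x}"
  proof (intro Set.set_eqI iffI)
    fix y assume "y \<in> {y \<in> \<Union>(set \<sigma>). y < x}"
    then obtain l where l: "l < length \<sigma>" "y \<in> \<sigma> ! l" "y < x"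
      by (auto simp: in_set_conv_nth)
    then have "\<not> i < l"
      using blocks_less[OF assms(1), of i l x y] assms(3) by auto
    with l show "y \<in> (\<Union>l<i. \<sigma> ! l) \<union> {y \<in> \<sigma> ! i. y < x}"
      by (cases "l = i") (auto simp: not_less)
  next
    fix y assume "y \<in> (\<Union>l<i. \<sigma> ! l) \<union> {y \<in> \<sigma> ! i. y < x}"
    then obtain l where l: "l \<le> i" "y \<in> \<sigma> ! l" "l = i \<Longrightarrow> y < x"
      by (metis (no_types, lifting) UN_E UnE lessThan_iff less_imp_le less_irrefl mem_Collect_eq order_refl)
    then have "y < x"
      using blocks_less[OF assms(1), of l i y x] assms by (cases "l = i") auto
    moreover have "\<sigma> ! l \<in> set \<sigma>" using l assms by auto
    ultimately show "y \<in> {y \<in> \<Union>(set \<sigma>). y < x}"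
      using l by blast
  qed
  moreover have "(\<Union>l<i. \<sigma> ! l) \<inter> {y \<in> \<sigma> ! i. y < x} = {}"
  proof -
    have "False" if "l < i" "y \<in> \<sigma> ! l" "y \<in> \<sigma> ! i" for l y
      using blocks_less[OF assms(1) that(1) assms(2) that(2,3)] by simp
    then show ?thesis by blast
  qed
  moreover have "card (\<Union>l<i. \<sigma> ! l) = (\<Sum>l<i. card (\<sigma> ! l))"
  proof (intro card_UN_disjoint ballI impI)
    fix l m assume "l \<in> {..<i}" "m \<in> {..<i}" "l \<noteq> m"
    then show "\<sigma> ! l \<inter> \<sigma> ! m = {}"
      using blocks_index_unique[OF assms(1), of l m] assms(2) by auto
  qed (use assms fin in auto)
  moreover have "(\<Sum>l<i. card (\<sigma> ! l)) = (\<Sum>l<i. (card (\<sigma> ! l) - 1) + 1)"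
    using assms fin by (intro sum.cong) (auto simp: Suc_leI)
  then have "(\<Sum>l<i. card (\<sigma> ! l)) = (\<Sum>l<i. card (\<sigma> ! l) - 1) + i"
    by (simp only: sum.distrib) simp
  ultimately show ?thesis
    using assms fin by (simp add: card_Un_disjoint)
qed

lemma face_sign_index:
  assumes "blocks \<sigma>" "i < length \<sigma>" "x \<in> \<sigma> ! i"
  shows "face_sign \<sigma> x = (-1) ^ ((\<Sum>l<i. card (\<sigma> ! l) - 1) + card {y \<in> \<sigma> ! i. y < x})"
  unfolding face_sign_def blocks_below_index[OF assms] card_below[OF assms]
  by (simp add: power_add)

lemma product_incidence_face_sign:
  assumes "blocks \<sigma>"
  shows "product_incidence \<sigma> \<tau> = (\<Sum>x\<in>\<Union>(set \<sigma>). if \<tau> = del x \<sigma> then face_sign \<sigma> x else 0)"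
proof -
  have "product_incidence \<sigma> \<tau> = (\<Sum>i<length \<sigma>. \<Sum>x\<in>\<sigma> ! i. if \<tau> = del x \<sigma> then face_sign \<sigma> x else 0)"
    unfolding product_incidence_def
    by (intro sum.cong refl) (simp add: blocks_update_eq_del face_sign_index assms)
  also have "\<dots> = (\<Sum>x\<in>(\<Union>i<length \<sigma>. \<sigma> ! i). if \<tau> = del x \<sigma> then face_sign \<sigma> x else 0)"
  proof (intro sum.UNION_disjoint[symmetric] ballI impI)
    fix l m assume "l \<in> {..<length \<sigma>}" "m \<in> {..<length \<sigma>}" "l \<noteq> m"
    then show "\<sigma> ! l \<inter> \<sigma> ! m = {}"
      using blocks_index_unique[OF assms, of l m] by auto
  qed (use assms in \<open>auto simp: blocks_def\<close>)
  also have "(\<Union>i<length \<sigma>. \<sigma> ! i) = \<Union>(set \<sigma>)"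
    unfolding set_conv_nth by blast
  finally show ?thesis .
qed

lemma product_incidence_del:
  assumes "blocks \<sigma>" "x \<in> \<Union>(set \<sigma>)"
  shows "product_incidence \<sigma> (del x \<sigma>) = face_sign \<sigma> x"
proof -
  have "del x \<sigma> = del z \<sigma> \<longleftrightarrow> x = z" if "z \<in> \<Union>(set \<sigma>)" for z
    using del_inject[OF assms(2) that] .
  then have "product_incidence \<sigma> (del x \<sigma>) = (\<Sum>z\<in>\<Union>(set \<sigma>). if x = z then face_sign \<sigma> z else 0)"
    unfolding product_incidence_face_sign[OF assms(1)] by (intro sum.cong) auto
  then show ?thesis
    using assms by (simp add: sum.delta finite_Union_blocks)
qed

lemma product_incidence_nonzero:
  assumes "blocks \<sigma>" "product_incidence \<sigma> \<tau> \<noteq> 0"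
  obtains x where "x \<in> \<Union>(set \<sigma>)" "\<tau> = del x \<sigma>"
proof -
  from assms(2) obtain x where "x \<in> \<Union>(set \<sigma>)"
    "(if \<tau> = del x \<sigma> then face_sign \<sigma> x else 0) \<noteq> 0"
    unfolding product_incidence_face_sign[OF assms(1)] by (rule sum.not_neutral_contains_not_neutral)
  then show thesis
    using that[of x] by (simp split: if_splits)
qed

text \<open>Deleting \<open>y\<close> removes one smaller vertex exactly when \<open>y < x\<close>,
  and since all factors stay nonempty the number of factors below \<open>x\<close> is unchanged. So
  of two vertices, exactly one has its sign reversed by the deletion of the other.\<close>

lemma face_sign_del:
  assumes "blocks \<sigma>" "blocks (del y \<sigma>)" "x \<in> \<Union>(set \<sigma>)" "x \<noteq> y" "y \<in> \<Union>(set \<sigma>)"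
  shows "face_sign (del y \<sigma>) x = (if y < x then - face_sign \<sigma> x else face_sign \<sigma> x)"
proof -
  obtain i where i: "i < length \<sigma>" "x \<in> \<sigma> ! i"
    using assms(3) by (auto simp: in_set_conv_nth)
  have below: "{l. l < length (del y \<sigma>) \<and> (\<forall>z\<in>del y \<sigma> ! l. z < x)} = {..<i}"
    using blocks_below_index[OF assms(2), of i x] i assms(4) by simp
  have fin: "finite {z \<in> \<Union>(set \<sigma>). z < x}"
    using finite_Union_blocks[OF assms(1)] by (rule rev_finite_subset) auto
  have eq: "{z \<in> \<Union>(set (del y \<sigma>)). z < x} = {z \<in> \<Union>(set \<sigma>). z < x} - {y}"
    unfolding Union_del by auto
  show ?thesis
  proof (cases "y < x")
    case True
    then have "y \<in> {z \<in> \<Union>(set \<sigma>). z < x}" using assms(5) by simp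
    then have "card {z \<in> \<Union>(set \<sigma>). z < x} = Suc (card {z \<in> \<Union>(set (del y \<sigma>)). z < x})"
      using fin unfolding eq by (metis card_Suc_Diff1)
    then show ?thesis
      using True unfolding face_sign_def below blocks_below_index[OF assms(1) i] by simp
  next
    case False
    then have "{z \<in> \<Union>(set (del y \<sigma>)). z < x} = {z \<in> \<Union>(set \<sigma>). z < x}"
      unfolding eq by auto
    then show ?thesis
      using False unfolding face_sign_def below blocks_below_index[OF assms(1) i] by simp
  qed
qed

section \<open>The boundary map squares to zero\<close>

abbreviation cell_dim :: "nat set list \<Rightarrow> nat" where
  "cell_dim \<sigma> \<equiv> (\<Sum>s\<leftarrow>\<sigma>. card s - 1)"

lemma hom_cells_blocks: "\<sigma> \<in> hom_cells d n E \<Longrightarrow> blocks \<sigma>"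
  unfolding hom_cells_def blocks_def by (auto intro: finite_subset)

lemma finite_hom_cells: "finite (hom_cells d n E)"
proof -
  have "hom_cells d n E \<subseteq> {\<sigma>. set \<sigma> \<subseteq> Pow {1..n} \<and> length \<sigma> = d}"
    unfolding hom_cells_def by blast
  then show ?thesis
    using finite_lists_length_eq[of "Pow {1..n}" d] by (auto intro: finite_subset)
qed

lemma hom_cells_del:
  assumes "\<sigma> \<in> hom_cells d n E" "\<forall>s\<in>set \<sigma>. s - {x} \<noteq> {}"
  shows "del x \<sigma> \<in> hom_cells d n E"
proof -
  have "set w \<in> E" if "list_all2 (\<in>) w (del x \<sigma>)" for w
  proof -
    have "list_all2 (\<in>) w \<sigma>"
      using that by (auto simp: list_all2_conv_all_nth)
    then show ?thesis
      using assms(1) by (auto simp: hom_cells_def)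
  qed
  then show ?thesis
    using assms by (auto simp: hom_cells_def del_def sorted_wrt_map elim: sorted_wrt_mono_rel[rotated])
qed

lemma cell_dim_del:
  assumes "\<sigma> \<in> hom_cells d n E" "del x \<sigma> \<in> hom_cells d n E" "x \<in> \<Union>(set \<sigma>)"
  shows "cell_dim \<sigma> = Suc (cell_dim (del x \<sigma>))"
proof -
  have b: "blocks \<sigma>" "blocks (del x \<sigma>)"
    using assms hom_cells_blocks by blast+
  have "card (\<Union>(set \<sigma>)) = Suc (card (\<Union>(set (del x \<sigma>))))"
    unfolding Union_del using finite_Union_blocks[OF b(1)] assms(3) by (metis card_Suc_Diff1)
  then show ?thesis
    using blocks_card[OF b(1)] blocks_card[OF b(2)] by simp
qed

text \<open>A face two dimensions down is reached by deleting two vertices in either order, hence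
  through exactly two intermediate cells. By \<open>face_sign_del\<close> one of the two orders
  reverses a sign and the other does not, so the contributions cancel.\<close>

lemma product_incidence_squared:
  assumes \<sigma>: "\<sigma> \<in> hom_cells d n E" and \<rho>: "\<rho> \<in> hom_cells d n E" and dim: "cell_dim \<sigma> = Suc k"
  shows "(\<Sum>\<tau> | \<tau> \<in> hom_cells d n E \<and> cell_dim \<tau> = k.
    product_incidence \<sigma> \<tau> * product_incidence \<tau> \<rho>) = 0" (is "sum ?f ?T = 0")
proof (cases "\<forall>\<tau>\<in>?T. ?f \<tau> = 0")
  case False
  note b\<sigma> = hom_cells_blocks[OF \<sigma>]
  have fins: "finite ?T" using finite_hom_cells[of d n E] by simp
  from False obtain \<tau>0 where \<tau>0: "\<tau>0 \<in> hom_cells d n E" "product_incidence \<sigma> \<tau>0 \<noteq> 0"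
    "product_incidence \<tau>0 \<rho> \<noteq> 0" by auto
  obtain x where x: "x \<in> \<Union>(set \<sigma>)" "\<tau>0 = del x \<sigma>"
    using product_incidence_nonzero[OF b\<sigma> \<tau>0(2)] .
  obtain y where y: "y \<in> \<Union>(set \<tau>0)" "\<rho> = del y \<tau>0"
    using product_incidence_nonzero[OF hom_cells_blocks[OF \<tau>0(1)] \<tau>0(3)] .
  have y': "y \<in> \<Union>(set \<sigma>)" "x \<noteq> y"
    using y(1) unfolding x(2) Union_del by auto
  have \<rho>_eq: "\<rho> = del y (del x \<sigma>)" "\<rho> = del x (del y \<sigma>)"
    using x(2) y(2) del_commute by simp_all
  \<comment> \<open>The factor keeps an element even when both \<open>x\<close> and \<open>y\<close>
    are deleted, since \<open>\<rho>\<close> is a cell. So the second route also passes through a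
    cell.\<close>
  have "\<forall>s\<in>set \<sigma>. s - {y} \<noteq> {}"
    using hom_cells_blocks[OF \<rho>] unfolding \<rho>_eq(1) by (auto simp: blocks_def del_def)
  then have cells: "del x \<sigma> \<in> hom_cells d n E" "del y \<sigma> \<in> hom_cells d n E"
    using hom_cells_del[OF \<sigma>] \<tau>0 x(2) by auto
  have neq: "del x \<sigma> \<noteq> del y \<sigma>"
    using del_inject[OF x(1) y'(1)] y'(2) by simp
  have sub: "{del x \<sigma>, del y \<sigma>} \<subseteq> ?T"
    using cells cell_dim_del[OF \<sigma> cells(1) x(1)] cell_dim_del[OF \<sigma> cells(2) y'(1)] dim by auto
  have "?f \<tau> = 0" if \<tau>: "\<tau> \<in> ?T - {del x \<sigma>, del y \<sigma>}" for \<tau>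
  proof (rule ccontr)
    assume nz: "?f \<tau> \<noteq> 0"
    then obtain x' where x': "x' \<in> \<Union>(set \<sigma>)" "\<tau> = del x' \<sigma>"
      using product_incidence_nonzero[OF b\<sigma>, of \<tau>] by auto
    have "blocks \<tau>" using \<tau> hom_cells_blocks by auto
    then obtain y'' where "\<rho> = del y'' \<tau>"
      using product_incidence_nonzero[of \<tau> \<rho>] nz by auto
    then have "\<Union>(set \<sigma>) - {x'} - {y''} = \<Union>(set \<sigma>) - {x} - {y}"
      using \<rho>_eq x' Union_del by metis
    then have "x' = x \<or> x' = y"
      using x' by blast
    with x' \<tau> show False by auto
  qed
  then have "sum ?f ?T = sum ?f {del x \<sigma>, del y \<sigma>}"
    by (intro sum.mono_neutral_right fins sub) blast
  also have "\<dots> = face_sign \<sigma> x * face_sign (del x \<sigma>) y + face_sign \<sigma> y * face_sign (del y \<sigma>) x"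
  proof -
    have "product_incidence (del x \<sigma>) \<rho> = face_sign (del x \<sigma>) y"
      unfolding \<rho>_eq(1) using y' Union_del[of x \<sigma>] hom_cells_blocks[OF cells(1)]
      by (intro product_incidence_del) auto
    moreover have "product_incidence (del y \<sigma>) \<rho> = face_sign (del y \<sigma>) x"
      unfolding \<rho>_eq(2) using x(1) y' Union_del[of y \<sigma>] hom_cells_blocks[OF cells(2)]
      by (intro product_incidence_del) auto
    ultimately show ?thesis
      using neq product_incidence_del[OF b\<sigma> x(1)] product_incidence_del[OF b\<sigma> y'(1)] by simp
  qed
  also have "\<dots> = 0"
    using y' x(1) face_sign_del[OF b\<sigma> hom_cells_blocks[OF cells(2)], of x]
      face_sign_del[OF b\<sigma> hom_cells_blocks[OF cells(1)], of y]
    by (cases "y < x") auto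
  finally show ?thesis .
qed (rule sum.neutral)

lemma card_nth_cell_dim_0:
  assumes "cell_dim \<tau> = 0" "i < length \<tau>"
  shows "card (\<tau> ! i) \<le> 1"
proof -
  have "\<tau> ! i \<in> set \<tau>" using assms(2) by simp
  then show ?thesis using assms(1) by simp
qed

text \<open>The augmentation to the empty cell is not an incidence number, so the last composition
  is treated separately. A cell of dimension 1 is a product of singletons and one factor
  \<open>{x, y}\<close>; its ends have opposite signs because \<open>x\<close> is the only vertex
  counted for \<open>y\<close> but not for \<open>x\<close>.\<close>

lemma product_incidence_edge:
  assumes \<sigma>: "\<sigma> \<in> hom_cells d n E" and dim: "cell_dim \<sigma> = 1"
  shows "(\<Sum>\<tau> | \<tau> \<in> hom_cells d n E \<and> cell_dim \<tau> = 0. product_incidence \<sigma> \<tau>) = 0"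
    (is "sum ?f ?T = 0")
proof -
  note b\<sigma> = hom_cells_blocks[OF \<sigma>]
  have "\<exists>s\<in>set \<sigma>. \<not> card s \<le> 1"
  proof (rule ccontr)
    assume "\<not> ?thesis"
    then have "map (\<lambda>s. card s - 1) \<sigma> = map (\<lambda>s. 0) \<sigma>" by auto
    then have "cell_dim \<sigma> = 0" by (simp only: sum_list_0)
    with dim show False by simp
  qed
  then obtain i where i: "i < length \<sigma>" "\<not> card (\<sigma> ! i) \<le> 1"
    by (metis in_set_conv_nth)
  have "\<exists>x y. x \<in> \<sigma> ! i \<and> y \<in> \<sigma> ! i \<and> x < y"
  proof (rule ccontr)
    assume neg: "\<nexists>x y. x \<in> \<sigma> ! i \<and> y \<in> \<sigma> ! i \<and> x < y"
    have "finite (\<sigma> ! i)" using b\<sigma> i by (auto simp: blocks_def)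
    moreover have "x = y" if "x \<in> \<sigma> ! i" "y \<in> \<sigma> ! i" for x y
      using neg that by (metis nat_neq_iff)
    ultimately have "card (\<sigma> ! i) \<le> Suc 0"
      by (auto simp: card_le_Suc0_iff_eq)
    with i show False by simp
  qed
  then obtain x y where xy: "x \<in> \<sigma> ! i" "y \<in> \<sigma> ! i" "x < y" by blast
  have U: "x \<in> \<Union>(set \<sigma>)" "y \<in> \<Union>(set \<sigma>)"
    using xy i by (auto intro!: bexI[OF _ nth_mem])
  have ne: "\<forall>s\<in>set \<sigma>. s - {z} \<noteq> {}" if z: "z \<in> {x, y}" for z
  proof
    fix s assume "s \<in> set \<sigma>"
    then obtain j where j: "j < length \<sigma>" "s = \<sigma> ! j" by (auto simp: in_set_conv_nth)
    show "s - {z} \<noteq> {}"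
    proof (cases "j = i")
      case True
      then show ?thesis using j xy z by auto
    next
      case False
      then have "z \<notin> s" using blocks_index_unique[OF b\<sigma> i(1) j(1), of z] j xy z by auto
      then show ?thesis using b\<sigma> \<open>s \<in> set \<sigma>\<close> by (auto simp: blocks_def)
    qed
  qed
  have cells: "del x \<sigma> \<in> hom_cells d n E" "del y \<sigma> \<in> hom_cells d n E"
    using ne hom_cells_del[OF \<sigma>] by auto
  have neq: "del x \<sigma> \<noteq> del y \<sigma>"
    using del_inject[OF U] xy by simp
  have sub: "{del x \<sigma>, del y \<sigma>} \<subseteq> ?T"
  proof -
    have "cell_dim (del x \<sigma>) = 0" "cell_dim (del y \<sigma>) = 0"
      using cell_dim_del[OF \<sigma> cells(1) U(1)] cell_dim_del[OF \<sigma> cells(2) U(2)] dim by linarith+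
    then show ?thesis using cells by blast
  qed
  \<comment> \<open>With \<open>z\<close> removed the cell would have dimension 0, yet its factor
    \<open>i\<close> would still contain both \<open>x\<close> and \<open>y\<close>.\<close>
  have third: "del z \<sigma> \<notin> hom_cells d n E" if z: "z \<in> \<Union>(set \<sigma>)" "z \<noteq> x" "z \<noteq> y" for z
  proof
    assume "del z \<sigma> \<in> hom_cells d n E"
    then have "cell_dim (del z \<sigma>) = 0"
      using cell_dim_del[OF \<sigma> _ z(1)] dim by linarith
    then have "card (del z \<sigma> ! i) \<le> 1"
      by (rule card_nth_cell_dim_0) (simp add: i)
    moreover have "finite (del z \<sigma> ! i)"
      using i b\<sigma> by (auto simp: blocks_def)
    moreover have "{x, y} \<subseteq> del z \<sigma> ! i" using xy z i by auto
    ultimately have "card {x, y} \<le> 1" by (metis card_mono le_trans)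
    with xy show False by simp
  qed
  have "?f \<tau> = 0" if \<tau>: "\<tau> \<in> ?T - {del x \<sigma>, del y \<sigma>}" for \<tau>
  proof (rule ccontr)
    assume "?f \<tau> \<noteq> 0"
    then obtain z where z: "z \<in> \<Union>(set \<sigma>)" "\<tau> = del z \<sigma>"
      using product_incidence_nonzero[OF b\<sigma>, of \<tau>] by blast
    then show False using \<tau> third[OF z(1)] by auto
  qed
  then have "sum ?f ?T = sum ?f {del x \<sigma>, del y \<sigma>}"
    using finite_hom_cells[of d n E] by (intro sum.mono_neutral_right sub) auto
  also have "\<dots> = face_sign \<sigma> x + face_sign \<sigma> y"
    using neq product_incidence_del[OF b\<sigma> U(1)] product_incidence_del[OF b\<sigma> U(2)] by simp
  also have "face_sign \<sigma> y = - face_sign \<sigma> x"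
  proof -
    \<comment> \<open>A vertex strictly between \<open>x\<close> and \<open>y\<close> would lie in
      the same factor, so deleting it would leave a cell, which \<open>third\<close>
      excludes.\<close>
    have below: "{z \<in> \<Union>(set \<sigma>). z < y} = insert x {z \<in> \<Union>(set \<sigma>). z < x}"
    proof (rule ccontr)
      assume "\<not> ?thesis"
      then obtain z where z: "z \<in> \<Union>(set \<sigma>)" "x < z" "z < y"
        using U xy by fastforce
      then obtain j where j: "j < length \<sigma>" "z \<in> \<sigma> ! j" by (auto simp: in_set_conv_nth)
      then have "j = i"
        using z xy i blocks_less[OF b\<sigma>, of i j y z] blocks_less[OF b\<sigma>, of j i z x]
        by (metis less_asym nat_neq_iff)
      then have "del z \<sigma> \<in> hom_cells d n E"
      proof (intro hom_cells_del[OF \<sigma>] ballI)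
        fix s assume "s \<in> set \<sigma>"
        then obtain l where l: "l < length \<sigma>" "s = \<sigma> ! l" by (auto simp: in_set_conv_nth)
        show "s - {z} \<noteq> {}"
        proof (cases "l = i")
          case True
          then show ?thesis using l xy z by auto
        next
          case False
          then have "z \<notin> s" using blocks_index_unique[OF b\<sigma> j(1) l(1), of z] l j \<open>j = i\<close> by auto
          then show ?thesis using b\<sigma> \<open>s \<in> set \<sigma>\<close> by (auto simp: blocks_def)
        qed
      qed
      then show False using third[OF z(1)] z by blast
    qed
    have "finite {z \<in> \<Union>(set \<sigma>). z < x}"
      using finite_Union_blocks[OF b\<sigma>] by (rule rev_finite_subset) auto
    then have "card {z \<in> \<Union>(set \<sigma>). z < y} = Suc (card {z \<in> \<Union>(set \<sigma>). z < x})"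
      unfolding below by simp
    then show ?thesis
      unfolding face_sign_def blocks_below_index[OF b\<sigma> i(1) xy(1)] blocks_below_index[OF b\<sigma> i(1) xy(2)]
      by simp
  qed
  finally show ?thesis by simp
qed

section \<open>Homogenization\<close>

lemma x_mon_diff_add:
  assumes "finite U" "V \<subseteq> U"
  shows "x_mon U - x_mon V + x_mon V = x_mon U"
  using assms finite_subset by (intro x_mon_dvd) (auto simp: keys_x_mon)

text \<open>Along a chain of faces the label quotients telescope, so all summands share one monomial
  and the integer identities apply to the coefficients. The orientation sign of the intermediate
  cell occurs twice and cancels; for \<open>k = 0\<close> it occurs once, but is 1 because the
  intermediate cells are vertices.\<close>

lemma cellular_complex_squared:
  fixes C :: "(nat set list option, 'k::field) free_complex"
  assumes C: "C = cellular_complex (reorient \<epsilon> (hom_complex d n E))"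
    and \<epsilon>: "orientation_change (hom_complex d n E) \<epsilon>"
    and c: "c \<in> basis C (Suc (Suc k))" and c'': "c'' \<in> basis C k"
  shows "(\<Sum>c'\<in>basis C (Suc k). bd C c c' * bd C c' c'') = 0"
proof -
  let ?X = "hom_cells d n E"
  let ?lab = "\<lambda>\<sigma>. x_mon (\<Union>(set \<sigma>))"
  from c obtain \<sigma> where \<sigma>: "c = Some \<sigma>" "\<sigma> \<in> ?X" "cell_dim \<sigma> = Suc k"
    by (auto simp: C cellular_complex_def hom_complex_def reorient_def)
  have bas: "basis C (Suc k) = Some ` {\<tau>. \<tau> \<in> ?X \<and> cell_dim \<tau> = k}"
    by (simp add: C cellular_complex_def hom_complex_def reorient_def)
  have \<epsilon>2: "\<epsilon> \<tau> * \<epsilon> \<tau> = 1" if "\<tau> \<in> ?X" for \<tau>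
    using \<epsilon> that by (auto simp: orientation_change_def hom_complex_def)
  have bd: "bd C (Some \<sigma>) (Some \<tau>) =
    Poly_Mapping.single (?lab \<sigma> - ?lab \<tau>) (of_int (\<epsilon> \<sigma> * \<epsilon> \<tau> * product_incidence \<sigma> \<tau>))"
    if "\<sigma> \<in> ?X" "\<tau> \<in> ?X" for \<sigma> \<tau>
    using that by (simp add: C cellular_complex_def hom_complex_def reorient_def blocks_x_mon hom_cells_blocks)
  have lab: "?lab \<sigma> - ?lab \<tau> + ?lab \<tau> = ?lab \<sigma>" if "\<sigma> \<in> ?X" "product_incidence \<sigma> \<tau> \<noteq> 0" for \<sigma> \<tau>
  proof -
    note b = hom_cells_blocks[OF that(1)]
    from product_incidence_nonzero[OF b that(2)] obtain x where "\<tau> = del x \<sigma>" by blast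
    then show ?thesis
      using finite_Union_blocks[OF b] by (intro x_mon_diff_add) (auto simp: Union_del)
  qed
  show ?thesis
  proof (cases k)
    case 0
    then have "c'' = None" using c'' by (simp add: C cellular_complex_def)
    have "bd C c (Some \<tau>) * bd C (Some \<tau>) c'' =
        Poly_Mapping.single (?lab \<sigma>) (of_int (\<epsilon> \<sigma> * product_incidence \<sigma> \<tau>))"
      if "\<tau> \<in> ?X" "cell_dim \<tau> = k" for \<tau>
    proof -
      have "bd C (Some \<tau>) None = monomial (?lab \<tau>)"
        using that by (simp add: C cellular_complex_def hom_complex_def reorient_def blocks_x_mon hom_cells_blocks)
      moreover have "\<epsilon> \<tau> = 1"
        using \<epsilon> that 0 by (auto simp: orientation_change_def hom_complex_def)
      ultimately show ?thesis
        using lab[OF \<sigma>(2), of \<tau>] bd[OF \<sigma>(2) that(1)] unfolding \<sigma>(1) \<open>c'' = None\<close>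
        by (cases "product_incidence \<sigma> \<tau> = 0") (simp_all add: monomial_def mult_single)
    qed
    then have "(\<Sum>c'\<in>basis C (Suc k). bd C c c' * bd C c' c'') =
      (\<Sum>\<tau> | \<tau> \<in> ?X \<and> cell_dim \<tau> = k. Poly_Mapping.single (?lab \<sigma>) (of_int (\<epsilon> \<sigma> * product_incidence \<sigma> \<tau>)))"
      unfolding bas by (subst sum.reindex) simp_all
    also have "\<dots> = Poly_Mapping.single (?lab \<sigma>) (of_int (\<epsilon> \<sigma> * (\<Sum>\<tau> | \<tau> \<in> ?X \<and> cell_dim \<tau> = k. product_incidence \<sigma> \<tau>)))"
      by (rule poly_mapping_eqI) (simp add: lookup_sum lookup_single sum_distrib_left when_def)
    also have "\<dots> = 0"
      using product_incidence_edge[OF \<sigma>(2)] \<sigma>(3) 0 by simp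
    finally show ?thesis .
  next
    case (Suc j)
    then obtain \<rho> where \<rho>: "c'' = Some \<rho>" "\<rho> \<in> ?X"
      using c'' by (auto simp: C cellular_complex_def hom_complex_def reorient_def)
    have "bd C c (Some \<tau>) * bd C (Some \<tau>) c'' = Poly_Mapping.single (?lab \<sigma> - ?lab \<rho>)
        (of_int (\<epsilon> \<sigma> * \<epsilon> \<rho> * (product_incidence \<sigma> \<tau> * product_incidence \<tau> \<rho>)))"
      if "\<tau> \<in> ?X" for \<tau>
    proof (cases "product_incidence \<sigma> \<tau> = 0 \<or> product_incidence \<tau> \<rho> = 0")
      case False
      then have "?lab \<sigma> - ?lab \<tau> + ?lab \<tau> = ?lab \<sigma>" "?lab \<tau> - ?lab \<rho> + ?lab \<rho> = ?lab \<tau>"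
        using lab \<sigma>(2) that by auto
      then have "?lab \<sigma> - ?lab \<tau> + (?lab \<tau> - ?lab \<rho>) = ?lab \<sigma> - ?lab \<rho>"
        by (metis add.assoc add_diff_cancel_right')
      moreover have "(\<epsilon> \<sigma> * \<epsilon> \<tau> * product_incidence \<sigma> \<tau>) * (\<epsilon> \<tau> * \<epsilon> \<rho> * product_incidence \<tau> \<rho>)
        = \<epsilon> \<sigma> * \<epsilon> \<rho> * (product_incidence \<sigma> \<tau> * product_incidence \<tau> \<rho>)"
        using \<epsilon>2[OF that] by (simp add: algebra_simps)
      ultimately show ?thesis
        unfolding \<sigma>(1) \<rho>(1) bd[OF \<sigma>(2) that] bd[OF that \<rho>(2)] mult_single
        by (simp only: flip: of_int_mult)
    qed (auto simp: \<sigma>(1) \<rho>(1) bd \<sigma>(2) \<rho>(2) that)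
    then have "(\<Sum>c'\<in>basis C (Suc k). bd C c c' * bd C c' c'') =
      (\<Sum>\<tau> | \<tau> \<in> ?X \<and> cell_dim \<tau> = k. Poly_Mapping.single (?lab \<sigma> - ?lab \<rho>)
        (of_int (\<epsilon> \<sigma> * \<epsilon> \<rho> * (product_incidence \<sigma> \<tau> * product_incidence \<tau> \<rho>))))"
      unfolding bas by (subst sum.reindex) simp_all
    also have "\<dots> = Poly_Mapping.single (?lab \<sigma> - ?lab \<rho>) (of_int (\<epsilon> \<sigma> * \<epsilon> \<rho> *
        (\<Sum>\<tau> | \<tau> \<in> ?X \<and> cell_dim \<tau> = k. product_incidence \<sigma> \<tau> * product_incidence \<tau> \<rho>)))"
      by (rule poly_mapping_eqI) (simp add: lookup_sum lookup_single sum_distrib_left when_def)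
    also have "\<dots> = 0"
      using product_incidence_squared[OF \<sigma>(2) \<rho>(2) \<sigma>(3)] by simp
    finally show ?thesis .
  qed
qed

text \<open>A nonzero coefficient forces \<open>c'\<close> to be the empty cell or a face, and for a
  face the truncated difference of labels is a true quotient.\<close>

lemma cellular_complex_homogeneous:
  fixes C :: "(nat set list option, 'k::field) free_complex"
  assumes C: "C = cellular_complex (reorient \<epsilon> (hom_complex d n E))"
    and c: "c \<in> basis C (Suc i)" and c': "c' \<in> basis C i"
    and m: "m \<in> Poly_Mapping.keys (bd C c c')"
  shows "m + mdeg C c' = mdeg C c"
proof -
  from c obtain \<sigma> where \<sigma>: "c = Some \<sigma>" "\<sigma> \<in> hom_cells d n E"
    by (auto simp: C cellular_complex_def hom_complex_def reorient_def)
  show ?thesis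
  proof (cases c')
    case None
    then show ?thesis
      using m \<sigma> by (simp add: C cellular_complex_def reorient_def monomial_def)
  next
    case (Some \<tau>)
    then have \<tau>: "\<tau> \<in> hom_cells d n E"
      using c' by (cases i) (auto simp: C cellular_complex_def hom_complex_def reorient_def)
    have m_eq: "m = x_mon (\<Union>(set \<sigma>)) - x_mon (\<Union>(set \<tau>))" and "product_incidence \<sigma> \<tau> \<noteq> 0"
      using m \<sigma> \<tau> unfolding Some
      by (auto simp: C cellular_complex_def reorient_def hom_complex_def blocks_x_mon hom_cells_blocks
          split: if_splits)
    from product_incidence_nonzero[OF hom_cells_blocks[OF \<sigma>(2)] this(2)]
    obtain x where "\<tau> = del x \<sigma>" by blast
    then have "m + x_mon (\<Union>(set \<tau>)) = x_mon (\<Union>(set \<sigma>))"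
      using finite_Union_blocks[OF hom_cells_blocks[OF \<sigma>(2)]] unfolding m_eq
      by (intro x_mon_diff_add) (auto simp: Union_del)
    then show ?thesis
      using \<sigma> \<tau> by (simp add: C Some cellular_complex_def reorient_def hom_complex_def
          blocks_x_mon hom_cells_blocks)
  qed
qed

section \<open>Cointerval hypergraphs\<close>

text \<open>The smallest vertex is lowered first: passing from \<open>a\<close> to
  \<open>b \<le> a\<close> enlarges the layer, and the remaining vertices are then lowered inside
  the layer of \<open>b\<close> by induction. At 1-graphs nothing is known, hence the condition
  \<open>last w = last v\<close>.\<close>

lemma cointerval_dominated:
  assumes "cointerval d V E" "length v = d" "list_all2 (\<le>) w v"
    "sorted_wrt (<) v" "sorted_wrt (<) w" "set v \<subseteq> V" "set w \<subseteq> V" "last w = last v" "set v \<in> E"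
  shows "set w \<in> E"
  using assms
proof (induction d V E arbitrary: v w rule: cointerval.induct)
  case (2 V E)
  then obtain a b where "v = [a]" "w = [b]"
    by (auto simp: length_Suc_conv list_all2_Cons2)
  with "2.prems" show ?case by simp
next
  case (3 d V E)
  from "3.prems"(2) obtain a v' where v: "v = a # v'" "length v' = Suc d"
    by (auto simp: length_Suc_conv)
  from "3.prems"(3) obtain b w' where w: "w = b # w'" "b \<le> a" "list_all2 (\<le>) w' v'"
    by (auto simp: v list_all2_Cons2)
  have b: "b \<in> V" and a: "a \<in> V" using "3.prems"(6,7) v w by auto
  have ne: "v' \<noteq> []" "w' \<noteq> []" using v w(3) by auto
  have "set v' \<in> layer a E"
    using "3.prems"(4,9) v by (auto simp: layer_def)
  moreover have "layer a E \<subseteq> layer b E" if "b < a"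
    using "3.prems"(1) a b that by simp
  ultimately have "set v' \<in> layer b E"
    using w(2) by (metis order_le_less subsetD)
  moreover have "last w' = last v'" using "3.prems"(8) ne by (simp add: v w)
  moreover have "set v' \<subseteq> {w \<in> V. b < w}" "set w' \<subseteq> {w \<in> V. b < w}"
    using "3.prems"(4-7) w(2) unfolding v w by auto
  ultimately have "set w' \<in> layer b E"
    using "3.prems"(1,4,5) v w b by (intro "3.IH"[OF b, of v' w']) simp_all
  then show ?case by (simp add: w layer_def)
qed simp

text \<open>At the first place where the words differ, \<open>w\<close> has the smaller entry, which
  does not occur in \<open>v\<close> at all. The induction carries this index explicitly, in the
  form that \<open>x_mon_less_iff\<close> expects.\<close>

lemma x_mon_dominated:
  assumes "list_all2 (\<le>) w v" "sorted_wrt (<) v" "sorted_wrt (<) w"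
  shows "x_mon (set v) \<le> x_mon (set w)"
proof -
  have "set w = set v \<or> (\<exists>k. k \<in> set w \<and> k \<notin> set v \<and> (\<forall>j<k. j \<in> set v \<longleftrightarrow> j \<in> set w))"
    using assms
  proof (induction rule: list_all2_induct)
    case (Cons b w a v)
    show ?case
    proof (cases "b = a")
      case True
      have gt: "a < k" if "k \<in> set w" for k using that Cons.prems True by simp
      from Cons consider "set w = set v"
        | k where "k \<in> set w" "k \<notin> set v" "\<forall>j<k. j \<in> set v \<longleftrightarrow> j \<in> set w"
        by auto
      then show ?thesis
      proof cases
        case (2 k)
        then have "k \<in> set (b # w) \<and> k \<notin> set (a # v) \<and>
            (\<forall>j<k. j \<in> set (a # v) \<longleftrightarrow> j \<in> set (b # w))"
          using gt[of k] True by simp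
        then show ?thesis by blast
      qed (use True in simp)
    next
      case False
      then have "b < a" using Cons by simp
      moreover have "\<forall>k\<in>set v. a < k" "\<forall>k\<in>set w. b < k" using Cons.prems by simp_all
      ultimately have "b \<in> set (b # w) \<and> b \<notin> set (a # v) \<and> (\<forall>j<b. j \<in> set (a # v) \<longleftrightarrow> j \<in> set (b # w))"
        by auto
      then show ?thesis by blast
    qed
  qed simp
  then show ?thesis
    using x_mon_less_iff[of "set v" "set w"] by auto
qed

section \<open>Cells built from an edge and added vertices\<close>

text \<open>The conditions make \<open>v\<close> the successor of \<open>s\<close> in
  \<open>e\<close>, hence unique; this assigns each \<open>s\<close> to one factor.\<close>

definition exchange_set :: "nat set set \<Rightarrow> nat set \<Rightarrow> nat set" where
  "exchange_set E e = {s. s \<notin> e \<and> (\<exists>v\<in>e. s < v \<and> (\<forall>u\<in>e. u < v \<longrightarrow> u < s) \<and> insert s (e - {v}) \<in> E)}"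

text \<open>An element of \<open>T\<close> joins the factor of its successor in \<open>e\<close>, so
  \<open>v\<close> stays the maximum of its factor.\<close>

definition block :: "nat set \<Rightarrow> nat set \<Rightarrow> nat \<Rightarrow> nat set" where
  "block e T v = insert v {t \<in> T. t < v \<and> (\<forall>u\<in>e. u < v \<longrightarrow> u < t)}"

definition cell :: "nat set \<Rightarrow> nat set \<Rightarrow> nat set list" where
  "cell e T = map (block e T) (sorted_list_of_set e)"

lemma block_le: "x \<in> block e T v \<Longrightarrow> x \<le> v"
  by (auto simp: block_def)

lemma blocks_cell:
  assumes "finite e" "finite T"
  shows "blocks (cell e T)"
proof -
  have "sorted_wrt (\<lambda>u v. \<forall>x\<in>block e T u. \<forall>y\<in>block e T v. x < y) (sorted_list_of_set e)"
  proof (rule sorted_wrt_mono_rel[OF _ strict_sorted_list_of_set])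
    fix u v assume uv: "u \<in> set (sorted_list_of_set e)" "v \<in> set (sorted_list_of_set e)" "u < v"
    have "u < y" if "y \<in> block e T v" for y
      using that uv assms by (auto simp: block_def)
    then show "\<forall>x\<in>block e T u. \<forall>y\<in>block e T v. x < y"
      using block_le[of _ e T u] le_less_trans by blast
  qed
  then show ?thesis
    using assms by (auto simp: blocks_def cell_def block_def sorted_wrt_map)
qed

lemma Union_cell:
  assumes "finite e" "T \<inter> e = {}" "\<forall>t\<in>T. \<exists>v\<in>e. t < v"
  shows "\<Union>(set (cell e T)) = e \<union> T"
proof -
  have "t \<in> \<Union>(block e T ` e)" if t: "t \<in> T" for t
  proof -
    \<comment> \<open>The successor of \<open>t\<close> in \<open>e\<close>; its factor receives
      \<open>t\<close>.\<close>
    let ?v = "Min {v\<in>e. t < v}"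
    have v: "?v \<in> {v\<in>e. t < v}"
      using assms t by (intro Min_in) auto
    have "u < t" if "u \<in> e" "u < ?v" for u
    proof (rule ccontr)
      assume "\<not> u < t"
      moreover have "u \<noteq> t" using assms(2) t that(1) by blast
      ultimately have "?v \<le> u" using assms(1) that(1) by (intro Min_le) auto
      with that(2) show False by simp
    qed
    then have "t \<in> block e T ?v" using v t by (simp add: block_def)
    then show ?thesis using v by blast
  qed
  moreover have "block e T v \<subseteq> insert v T" "v \<in> block e T v" for v
    by (auto simp: block_def)
  ultimately show ?thesis
    using assms(1) by (fastforce simp: cell_def)
qed

lemma Max_cell:
  assumes "finite e" "finite T"
  shows "map Max (cell e T) = sorted_list_of_set e"
proof -
  have "Max (block e T v) = v" for v
    using assms by (intro Max_eqI) (auto simp: block_def)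
  then show ?thesis by (simp add: cell_def comp_def)
qed

lemma Max_nth_block:
  assumes "blocks \<sigma>" "i < length \<sigma>"
  shows "Max (\<sigma> ! i) \<in> \<sigma> ! i" "\<And>x. x \<in> \<sigma> ! i \<Longrightarrow> x \<le> Max (\<sigma> ! i)"
  using assms by (auto simp: blocks_def)

text \<open>Every ordered product has the form \<open>cell e T\<close>, with the maxima of the
  factors as \<open>e\<close>. The hypergraph only decides which \<open>e\<close> and
  \<open>T\<close> occur.\<close>

lemma cell_Max:
  assumes "blocks \<sigma>"
  shows "sorted_list_of_set (Max ` set \<sigma>) = map Max \<sigma>"
    and "cell (Max ` set \<sigma>) (\<Union>(set \<sigma>) - Max ` set \<sigma>) = \<sigma>"
proof -
  note Max = Max_nth_block[OF assms]
  have "sorted_wrt (<) (map Max \<sigma>)"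
    unfolding sorted_wrt_iff_nth_less
  proof (intro allI impI)
    fix i j assume ij: "i < j" "j < length (map Max \<sigma>)"
    then have "Max (\<sigma> ! i) < Max (\<sigma> ! j)"
      using blocks_less[OF assms ij(1) _ Max(1) Max(1)] ij by simp
    then show "map Max \<sigma> ! i < map Max \<sigma> ! j" using ij by simp
  qed
  then have "sorted (map Max \<sigma>)" "distinct (map Max \<sigma>)"
    unfolding strict_sorted_iff by blast+
  from sorted_list_of_set.idem_if_sorted_distinct[OF this]
  show sorted: "sorted_list_of_set (Max ` set \<sigma>) = map Max \<sigma>"
    by (simp only: set_map)
  let ?e = "Max ` set \<sigma>"
  let ?T = "\<Union>(set \<sigma>) - ?e"
  have "block ?e ?T (Max (\<sigma> ! i)) = \<sigma> ! i" if i: "i < length \<sigma>" for i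
  proof (intro equalityI subsetI)
    fix x assume x: "x \<in> block ?e ?T (Max (\<sigma> ! i))"
    show "x \<in> \<sigma> ! i"
    proof (cases "x = Max (\<sigma> ! i)")
      case True then show ?thesis using Max(1)[OF i] by simp
    next
      case False
      then have "x \<in> \<Union>(set \<sigma>)" and lt: "x < Max (\<sigma> ! i)"
        and u: "\<forall>u\<in>?e. u < Max (\<sigma> ! i) \<longrightarrow> u < x"
        using x by (auto simp: block_def)
      then obtain j where j: "j < length \<sigma>" "x \<in> \<sigma> ! j" unfolding set_conv_nth by blast
      have "\<not> i < j"
        using blocks_less[OF assms _ j(1) Max(1)[OF i] j(2)] lt less_asym by blast
      \<comment> \<open>The maximum of factor \<open>j\<close> would belong to \<open>?e\<close> and
        lie below \<open>Max (\<sigma> ! i)\<close>, so it would have to lie below \<open>x\<close>,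
        which it bounds from above.\<close>
      moreover have False if "j < i"
      proof -
        have "Max (\<sigma> ! j) < Max (\<sigma> ! i)"
          using blocks_less[OF assms that i Max(1)[OF j(1)] Max(1)[OF i]] .
        moreover have "Max (\<sigma> ! j) \<in> ?e" using j(1) by simp
        ultimately have "Max (\<sigma> ! j) < x" using u by blast
        with Max(2)[OF j] show False by simp
      qed
      ultimately have "j = i" using nat_neq_iff by blast
      with j show ?thesis by simp
    qed
  next
    fix x assume x: "x \<in> \<sigma> ! i"
    show "x \<in> block ?e ?T (Max (\<sigma> ! i))"
    proof (cases "x = Max (\<sigma> ! i)")
      case False
      with Max(2)[OF i x] have lt: "x < Max (\<sigma> ! i)" by simp
      have u: "u < x" if ue: "u \<in> ?e" "u < Max (\<sigma> ! i)" for u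
      proof -
        obtain s where s: "s \<in> set \<sigma>" "u = Max s" using ue(1) by blast
        then obtain j where j: "j < length \<sigma>" "u = Max (\<sigma> ! j)"
          by (metis in_set_conv_nth)
        have "\<not> i < j"
          using blocks_less[OF assms _ j(1) Max(1)[OF i] Max(1)[OF j(1)]] that(2)
          unfolding j(2) by linarith
        moreover have "i \<noteq> j" using that(2) j(2) by auto
        ultimately have "j < i" by simp
        then show ?thesis
          using blocks_less[OF assms _ i Max(1)[OF j(1)] x] j(2) by simp
      qed
      have "x \<notin> ?e" using u lt by blast
      moreover have "x \<in> \<Union>(set \<sigma>)" using x i nth_mem by blast
      ultimately show ?thesis using lt u by (simp add: block_def)
    qed (simp add: block_def)
  qed
  then show "cell ?e ?T = \<sigma>"
    unfolding cell_def sorted by (intro nth_equalityI) simp_all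
qed

section \<open>Exchanges in a cointerval graph\<close>

locale cointerval_graph =
  fixes d n :: nat and E :: "nat set set"
  assumes d_graph: "d_graph d {1..n} E"
    and cointerval: "cointerval d {1..n} E"
begin

lemma finite_edge: "e \<in> E \<Longrightarrow> finite e"
  and edge_subset: "e \<in> E \<Longrightarrow> e \<subseteq> {1..n}"
  and card_edge: "e \<in> E \<Longrightarrow> card e = d"
  using d_graph by (auto simp: d_graph_def intro: finite_subset)

lemma finite_E: "finite E"
proof (rule finite_subset)
  show "E \<subseteq> Pow {1..n}" using edge_subset by blast
qed simp

lemma dominated:
  assumes "set v \<in> E" "list_all2 (\<le>) w v" "sorted_wrt (<) v" "sorted_wrt (<) w"
    "set w \<subseteq> {1..n}" "last w = last v"
  shows "set w \<in> E"
proof (rule cointerval_dominated[OF cointerval])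
  show "length v = d"
    using card_edge[OF assms(1)] assms(3) by (metis distinct_card strict_sorted_iff)
qed (use assms edge_subset in auto)

text \<open>The increasing word of \<open>e\<close> with \<open>v\<close> overwritten by
  \<open>s\<close> is still increasing and is dominated by the old one. The larger vertex
  \<open>v'\<close> guarantees that the last entry is untouched.\<close>

lemma exchange:
  assumes e: "e \<in> E" "v \<in> e" "v' \<in> e" "v < v'"
    and s: "s \<in> {1..n}" "s < v" "\<forall>u\<in>e. u < v \<longrightarrow> u < s"
  shows "insert s (e - {v}) \<in> E"
proof -
  note fin = finite_edge[OF e(1)]
  obtain as bs where l: "sorted_list_of_set e = as @ v # bs"
    using split_list[of v "sorted_list_of_set e"] e(2) fin by auto
  have sorted: "sorted_wrt (<) (as @ v # bs)"
    using strict_sorted_list_of_set[of e] unfolding l .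
  have set: "set (as @ v # bs) = e"
    using set_sorted_list_of_set[OF fin] unfolding l .
  have "bs \<noteq> []" using e(3,4) sorted set by (auto simp: sorted_wrt_append)
  have "set (as @ s # bs) \<in> E"
  proof (rule dominated[of "as @ v # bs"])
    show "sorted_wrt (<) (as @ s # bs)"
      using sorted s set by (auto simp: sorted_wrt_append)
    show "list_all2 (\<le>) (as @ s # bs) (as @ v # bs)"
      using s(2) by (intro list_all2_appendI) (auto simp: list_all2_same)
    show "set (as @ s # bs) \<subseteq> {1..n}"
      using s(1) set edge_subset[OF e(1)] by auto
  qed (use sorted set e \<open>bs \<noteq> []\<close> in simp_all)
  moreover have "set (as @ s # bs) = insert s (e - {v})"
    unfolding set[symmetric] using sorted by (auto simp: sorted_wrt_append)
  ultimately show ?thesis by simp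
qed

abbreviation X :: "nat set \<Rightarrow> nat set" where "X \<equiv> exchange_set E"

lemma X_subset: "X e \<subseteq> {1..n}"
proof
  fix s assume "s \<in> X e"
  then obtain v where "insert s (e - {v}) \<in> E" by (auto simp: exchange_set_def)
  with edge_subset show "s \<in> {1..n}" by blast
qed

lemma finite_X: "finite (X e)"
  using X_subset finite_subset by blast

lemma sub_X_D: "T \<subseteq> X e \<Longrightarrow> T \<inter> e = {} \<and> (\<forall>t\<in>T. \<exists>v\<in>e. t < v) \<and> finite T"
  using finite_subset[OF _ finite_X] by (auto simp: exchange_set_def)

lemma exchange_lex:
  assumes e: "e \<in> E" "v \<in> e" and s: "s \<notin> e" "s < v" "\<forall>u\<in>e. u < v \<longrightarrow> u < s"
  shows "x_mon e < x_mon (insert s (e - {v}))"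
proof -
  have "\<forall>j<s. j \<in> e \<longleftrightarrow> j \<in> insert s (e - {v})"
    using s by auto
  then show ?thesis
    using finite_edge[OF e(1)] s(1) by (subst x_mon_less_iff) auto
qed

text \<open>The first place \<open>s\<close> where \<open>f\<close> differs from \<open>e\<close> is
  a common element. A vertex of \<open>e\<close> above \<open>s\<close> exists, since otherwise
  \<open>e\<close> would be a proper subset of \<open>f\<close>, against equal cardinality. This is
  what makes the colon ideals linear.\<close>

lemma lex_before_exchange:
  assumes e: "e \<in> E" and f: "f \<in> E" and lex: "x_mon e < x_mon f"
  shows "f \<inter> X e \<noteq> {}"
proof -
  note fin = finite_edge[OF e] finite_edge[OF f]
  obtain s where s: "s \<in> f" "s \<notin> e" "\<forall>j<s. j \<in> e \<longleftrightarrow> j \<in> f"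
    using lex x_mon_less_iff[OF fin] by blast
  have "\<exists>v\<in>e. s < v"
  proof (rule ccontr)
    assume neg: "\<not> (\<exists>v\<in>e. s < v)"
    have "e \<subset> f"
    proof (rule psubsetI)
      show "e \<subseteq> f"
      proof
        fix j assume "j \<in> e"
        then have "j < s" using neg s(2) by (metis linorder_neqE_nat)
        with \<open>j \<in> e\<close> s(3) show "j \<in> f" by blast
      qed
    qed (use s in blast)
    then have "card e < card f" using fin by (intro psubset_card_mono)
    with card_edge[OF e] card_edge[OF f] show False by simp
  qed
  then have ne: "{v\<in>e. s < v} \<noteq> {}" by blast
  define v where "v = Min {v\<in>e. s < v}"
  have v: "v \<in> e" "s < v"
    using Min_in[OF _ ne] fin unfolding v_def by auto
  have u: "\<forall>u\<in>e. u < v \<longrightarrow> u < s"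
  proof (intro ballI impI)
    fix u assume uv: "u \<in> e" "u < v"
    show "u < s"
    proof (rule ccontr)
      assume "\<not> u < s"
      with s(2) uv(1) have "s < u" by (metis linorder_neqE_nat)
      then have "v \<le> u" unfolding v_def using fin uv(1) by (intro Min_le) auto
      with uv(2) show False by simp
    qed
  qed
  have "insert s (e - {v}) \<in> E"
  proof (cases "\<exists>v'\<in>e. v < v'")
    case True
    then show ?thesis using exchange[OF e v(1)] s(1) edge_subset[OF f] v(2) u by blast
  next
    \<comment> \<open>If the successor \<open>v\<close> of \<open>s\<close> is the last vertex, all
      others lie below \<open>s\<close> and so belong to \<open>f\<close>. The exchanged set is then
      contained in \<open>f\<close> and has its size, so it is the edge \<open>f\<close>
      itself.\<close>
    case False
    have "e - {v} \<subseteq> f"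
    proof
      fix j assume j: "j \<in> e - {v}"
      then have "j < v" using False by (metis DiffE insertI1 linorder_neqE_nat)
      then show "j \<in> f" using u s(3) j by blast
    qed
    then have "insert s (e - {v}) \<subseteq> f" using s(1) by blast
    moreover have "card (insert s (e - {v})) = card f"
      using fin s(2) v(1) card_edge[OF e] card_edge[OF f]
      by (metis Diff_iff card_Suc_Diff1 card_insert_disjoint finite_Diff)
    ultimately have "insert s (e - {v}) = f" using fin by (metis card_subset_eq)
    then show ?thesis using f by simp
  qed
  then have "s \<in> X e" using s(2) v u by (auto simp: exchange_set_def)
  with s(1) show ?thesis by blast
qed

text \<open>Take \<open>K\<close> to be the support of a monomial: the left side says that its
  product with the generator of \<open>e\<close> is divisible by an earlier generator, the right
  side that it is divisible by a variable from \<open>X e\<close>.\<close>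

lemma exchange_set_iff:
  assumes "e \<in> E"
  shows "(\<exists>f\<in>E. x_mon e < x_mon f \<and> f \<subseteq> K \<union> e) \<longleftrightarrow> (\<exists>s\<in>X e. s \<in> K)"
proof
  assume "\<exists>f\<in>E. x_mon e < x_mon f \<and> f \<subseteq> K \<union> e"
  then obtain f where "f \<in> E" "x_mon e < x_mon f" "f \<subseteq> K \<union> e" by blast
  moreover from this obtain s where "s \<in> f" "s \<in> X e"
    using lex_before_exchange[OF assms] by blast
  moreover from this have "s \<notin> e" by (simp add: exchange_set_def)
  ultimately show "\<exists>s\<in>X e. s \<in> K" by blast
next
  assume "\<exists>s\<in>X e. s \<in> K"
  then obtain s v where s: "s \<in> K" "s \<notin> e" "v \<in> e" "s < v" "\<forall>u\<in>e. u < v \<longrightarrow> u < s"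
    "insert s (e - {v}) \<in> E" by (auto simp: exchange_set_def)
  then show "\<exists>f\<in>E. x_mon e < x_mon f \<and> f \<subseteq> K \<union> e"
    using exchange_lex[OF assms s(3,2,4,5)] by blast
qed


section \<open>Cells over initial segments of the edges\<close>

text \<open>The edge sets of the prefixes of the lexicographic list; they are upward closed because
  larger monomials come first.\<close>

definition lex_initial :: "nat set set \<Rightarrow> bool" where
  "lex_initial E' \<longleftrightarrow> E' \<subseteq> E \<and> (\<forall>g\<in>E'. \<forall>f\<in>E. x_mon g < x_mon f \<longrightarrow> f \<in> E')"

text \<open>The last vertex of \<open>e\<close> is exchanged first, which the definition of
  \<open>X e\<close> permits; the others are then lowered by \<open>dominated\<close>, which keeps
  the last entry. The result is not lexicographically smaller than \<open>e\<close>, so it stays in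
  \<open>E'\<close>.\<close>

lemma cell_vertices:
  assumes E': "lex_initial E'" and e: "e \<in> E'" and T: "T \<subseteq> X e" and w: "list_all2 (\<in>) w (cell e T)"
  shows "set w \<in> E'"
proof -
  have eE: "e \<in> E" using E' e by (auto simp: lex_initial_def)
  note fin = finite_edge[OF eE] and T' = sub_X_D[OF T]
  have b: "blocks (cell e T)" using fin T' by (intro blocks_cell) auto
  have wl: "length w = length (cell e T)" using w by (simp add: list_all2_lengthD)
  have sw: "sorted_wrt (<) w"
    unfolding sorted_wrt_iff_nth_less
  proof (intro allI impI)
    fix i j assume "i < j" "j < length w"
    moreover from this have "w ! i \<in> cell e T ! i" "w ! j \<in> cell e T ! j"
      using list_all2_nthD[OF w] by simp_all
    ultimately show "w ! i < w ! j"
      using blocks_less[OF b, of i j "w ! i" "w ! j"] wl by simp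
  qed
  have "set w \<subseteq> \<Union>(set (cell e T))"
  proof
    fix x assume "x \<in> set w"
    then obtain i where i: "i < length w" "x = w ! i" by (metis in_set_conv_nth)
    then have "x \<in> cell e T ! i" using list_all2_nthD[OF w i(1)] by simp
    then show "x \<in> \<Union>(set (cell e T))" using i(1) wl nth_mem[of i "cell e T"] by auto
  qed
  then have wn: "set w \<subseteq> {1..n}"
    using Union_cell[OF fin, of T] T' T X_subset[of e] edge_subset[OF eE] by blast
  let ?l = "sorted_list_of_set e"
  have sl: "sorted_wrt (<) ?l" "set ?l = e" using fin by simp_all
  have le: "list_all2 (\<le>) w ?l"
    using w unfolding cell_def list_all2_map2 by (rule list_all2_mono) (rule block_le)
  have "set w \<in> E"
  proof (cases "?l = []")
    case True
    then show ?thesis using le sl eE by simp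
  next
    case False
    then obtain us m where l: "?l = us @ [m]" by (metis rev_exhaust)
    from w obtain w' s where w': "w = w' @ [s]" "list_all2 (\<in>) w' (map (block e T) us)" "s \<in> block e T m"
      unfolding cell_def l by (auto simp: list_all2_append2 list_all2_Cons2)
    have le': "list_all2 (\<le>) w' us"
      using w'(2) unfolding list_all2_map2 by (rule list_all2_mono) (rule block_le)
    have m: "m \<in> e" "\<And>u. u \<in> set us \<Longrightarrow> u < m" "e = insert m (set us)"
      using sl unfolding l by (auto simp: sorted_wrt_append)
    have us: "e - {m} = set us" using m by auto
    have "set (us @ [s]) \<in> E"
    proof (cases "s = m")
      case True
      then show ?thesis using sl eE by (simp add: l)
    next
      case False
      then have s: "s \<in> T" "s < m" "\<forall>u\<in>e. u < m \<longrightarrow> u < s" using w'(3) by (auto simp: block_def)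
      then obtain v where v: "v \<in> e" "s < v" "insert s (e - {v}) \<in> E"
        using T by (auto simp: exchange_set_def)
      \<comment> \<open>All other vertices of \<open>e\<close> lie below \<open>s\<close>, so the
        partner of \<open>s\<close> in the definition of \<open>X e\<close> must be
        \<open>m\<close>.\<close>
      have "v = m" using v s m by (metis insertE less_asym)
      then show ?thesis using v us by simp
    qed
    moreover have "sorted_wrt (<) (us @ [s])"
    proof -
      have "u < s" if "u \<in> set us" for u
        using that m w'(3) by (auto simp: block_def)
      then show ?thesis using sl(1) unfolding l by (simp add: sorted_wrt_append)
    qed
    moreover have "list_all2 (\<le>) w (us @ [s])"
      unfolding w'(1) using le' by (intro list_all2_appendI) auto
    ultimately show ?thesis
      using sw wn w'(1) by (intro dominated[of "us @ [s]" w]) simp_all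
  qed
  moreover have "x_mon e \<le> x_mon (set w)"
    using x_mon_dominated[OF le sl(1) sw] sl(2) by simp
  moreover have "x_mon e = x_mon (set w) \<Longrightarrow> e = set w"
    using fin by (metis keys_x_mon finite_set)
  ultimately show ?thesis
    using E' e unfolding lex_initial_def by (metis order_le_less)
qed

lemma cell_in_hom_cells:
  assumes E': "lex_initial E'" and e: "e \<in> E'" and T: "T \<subseteq> X e"
  shows "cell e T \<in> hom_cells d n E'"
proof -
  have eE: "e \<in> E" using E' e by (auto simp: lex_initial_def)
  note fin = finite_edge[OF eE] and T' = sub_X_D[OF T]
  have b: "blocks (cell e T)" using fin T' by (intro blocks_cell) auto
  have "\<Union>(set (cell e T)) \<subseteq> {1..n}"
    using Union_cell[OF fin, of T] T' T X_subset[of e] edge_subset[OF eE] by blast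
  moreover have "length (cell e T) = d"
    using card_edge[OF eE] by (simp add: cell_def)
  ultimately show ?thesis
    using b cell_vertices[OF assms] unfolding hom_cells_def blocks_def by blast
qed

text \<open>The maxima of the factors form a vertex of the cell, which serves as \<open>e\<close>;
  it remains to see that the other elements lie in its exchange set.\<close>

lemma hom_cell_is_cell:
  assumes E': "lex_initial E'" and \<sigma>: "\<sigma> \<in> hom_cells d n E'"
  obtains e T where "e \<in> E'" "T \<subseteq> X e" "\<sigma> = cell e T"
proof
  let ?e = "Max ` set \<sigma>"
  let ?T = "\<Union>(set \<sigma>) - ?e"
  note b = hom_cells_blocks[OF \<sigma>]
  note Max = Max_nth_block[OF b]
  have vert: "set w \<in> E'" if "list_all2 (\<in>) w \<sigma>" for w
    using \<sigma> that by (auto simp: hom_cells_def)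
  have MaxV: "list_all2 (\<in>) (map Max \<sigma>) \<sigma>"
    using Max(1) by (auto simp: list_all2_conv_all_nth)
  then show "?e \<in> E'" using vert[of "map Max \<sigma>"] by simp
  show "\<sigma> = cell ?e ?T" using cell_Max(2)[OF b] by simp
  show "?T \<subseteq> X ?e"
  proof
    fix t assume t: "t \<in> ?T"
    then obtain i where i: "i < length \<sigma>" "t \<in> \<sigma> ! i" unfolding set_conv_nth by blast
    have Me: "Max (\<sigma> ! i) \<in> ?e" using i by simp
    have "t \<noteq> Max (\<sigma> ! i)" using Me t by blast
    then have "t < Max (\<sigma> ! i)" using Max(2)[OF i] by simp
    moreover have "\<forall>u\<in>?e. u < Max (\<sigma> ! i) \<longrightarrow> u < t"
    proof (intro ballI impI)
      fix u assume "u \<in> ?e" and lt: "u < Max (\<sigma> ! i)"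
      then obtain s where s: "s \<in> set \<sigma>" "u = Max s" by blast
      then obtain j where j: "j < length \<sigma>" "u = Max (\<sigma> ! j)"
        by (metis in_set_conv_nth)
      have "\<not> i < j"
        using blocks_less[OF b _ j(1) Max(1)[OF i(1)] Max(1)[OF j(1)]] lt
        unfolding j(2) by linarith
      moreover have "i \<noteq> j" using lt j(2) by auto
      ultimately have "j < i" by simp
      then show "u < t"
        using blocks_less[OF b _ i(1) Max(1)[OF j(1)] i(2)] j(2) by simp
    qed
    \<comment> \<open>This is the vertex of the cell that takes \<open>t\<close> in factor
      \<open>i\<close> and the maximum in every other factor.\<close>
    moreover have "insert t (?e - {Max (\<sigma> ! i)}) \<in> E"
    proof -
      have "distinct (map Max \<sigma>)"
        using cell_Max(1)[OF b] by (metis distinct_sorted_list_of_set)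
      then have "set ((map Max \<sigma>)[i := t]) = insert t (?e - {Max (\<sigma> ! i)})"
        using i by (subst set_update_distinct) simp_all
      moreover have "list_all2 (\<in>) ((map Max \<sigma>)[i := t]) \<sigma>"
        using Max(1) i by (auto simp: list_all2_conv_all_nth nth_list_update)
      ultimately show ?thesis using vert E' unfolding lex_initial_def by (metis subsetD)
    qed
    ultimately show "t \<in> X ?e" using t Me unfolding exchange_set_def by blast
  qed
qed

text \<open>The maxima of the factors return \<open>e\<close>, and the union of the factors returns
  \<open>e \<union> T\<close>.\<close>

lemma cell_inject:
  assumes "finite e" "finite e'" "T \<subseteq> X e" "T' \<subseteq> X e'" "cell e T = cell e' T'"
  shows "e = e' \<and> T = T'"
proof -
  note T = sub_X_D[OF assms(3)] sub_X_D[OF assms(4)]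
  have "e = e'"
    using Max_cell[OF assms(1), of T] Max_cell[OF assms(2), of T'] T assms(1,2,5)
    by (metis set_sorted_list_of_set)
  moreover have "e \<union> T = e' \<union> T'"
    using Union_cell[OF assms(1), of T] Union_cell[OF assms(2), of T'] T assms(5) by simp
  ultimately show ?thesis using T by blast
qed

end

section \<open>The iterated mapping cone\<close>

lemma bij_betw_map_option_Some:
  assumes "bij_betw f A B"
  shows "bij_betw (map_option f) (Some ` A) (Some ` B)"
proof -
  have "map_option f ` Some ` A = Some ` f ` A" by (simp only: image_image option.map)
  moreover have "inj_on (map_option f) (Some ` A)"
    using bij_betw_imp_inj_on[OF assms] by (auto simp: inj_on_def)
  ultimately show ?thesis
    using bij_betw_imp_surj_on[OF assms] by (simp add: bij_betw_def)
qed

definition cell_of :: "cone_basis \<Rightarrow> nat set list option" where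
  "cell_of = map_option (\<lambda>(e, T). cell e T)"

lemma cell_of_simps [simp]: "cell_of None = None" "cell_of (Some (e, T)) = Some (cell e T)"
  by (simp_all add: cell_of_def)

context cointerval_graph
begin

section \<open>Comparison of cone bases and cells\<close>

definition cell_complex :: "nat set set \<Rightarrow> (nat set list option, 'k::field) free_complex" where
  "cell_complex E' = cellular_complex (reorient (\<lambda>\<sigma>. (-1) ^ cell_dim \<sigma>) (hom_complex d n E'))"

text \<open>Degree 0 is the ring itself, so a subset of size \<open>j\<close>, like a cell of
  dimension \<open>j\<close>, sits in degree \<open>Suc j\<close>. This is the degree shift of the
  cone.\<close>

definition cone_elements :: "nat set set \<Rightarrow> nat \<Rightarrow> cone_basis set" where
  "cone_elements E' i = (case i of 0 \<Rightarrow> {None} |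
     Suc j \<Rightarrow> Some ` {(e, T). e \<in> E' \<and> T \<subseteq> X e \<and> card T = j})"

text \<open>The invariant of the induction. Each stage is compared with the complex of the full
  \<open>E\<close>, since labels and incidence numbers do not depend on the edge set; so the
  comparison of earlier elements survives the next step unchanged.\<close>

definition cone_of_cells :: "nat set set \<Rightarrow> (cone_basis, 'k::field) free_complex \<Rightarrow> bool" where
  "cone_of_cells E' F \<longleftrightarrow>
     (\<forall>i. basis F i = cone_elements E' i) \<and>
     (\<forall>i. \<forall>b\<in>basis F i. mdeg F b = mdeg (cell_complex E :: (_, 'k) free_complex) (cell_of b)) \<and>
     (\<forall>i. \<forall>b\<in>basis F (Suc i). \<forall>b'\<in>basis F i. bd F b b' = bd (cell_complex E) (cell_of b) (cell_of b'))"

lemma orientation_change_dim: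
  "orientation_change (hom_complex d n E') (\<lambda>\<sigma>. (-1) ^ cell_dim \<sigma>)"
proof -
  have "(-1 :: int) ^ k \<in> {1, -1}" for k :: nat by (cases "even k") simp_all
  then show ?thesis
    unfolding orientation_change_def hom_complex_def labeled_complex.simps by (metis power_0)
qed

lemma basis_cell_complex:
  "basis (cell_complex E') 0 = {None}"
  "basis (cell_complex E') (Suc j) = Some ` {\<sigma> \<in> hom_cells d n E'. cell_dim \<sigma> = j}"
  by (simp_all add: cell_complex_def cellular_complex_def reorient_def hom_complex_def)

lemma cell_complex_cong:
  "mdeg (cell_complex E' :: (_, 'k::field) free_complex) = mdeg (cell_complex E :: (_, 'k) free_complex)"
  "bd (cell_complex E') = bd (cell_complex E)"
  by (auto simp: cell_complex_def cellular_complex_def reorient_def hom_complex_def fun_eq_iff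
      split: option.split)

lemma mdeg_cell_None: "mdeg (cell_complex E') None = 0"
  by (simp add: cell_complex_def cellular_complex_def)

lemma lex_initial_subset: "lex_initial E' \<Longrightarrow> E' \<subseteq> E"
  by (simp add: lex_initial_def)

lemma lex_initial_E: "lex_initial E"
  by (simp add: lex_initial_def)

lemma finite_sub_X: "T \<subseteq> X e \<Longrightarrow> finite T"
  and disjoint_sub_X: "T \<subseteq> X e \<Longrightarrow> T \<inter> e = {}"
  by (simp_all add: sub_X_D)

lemma Union_cell_X:
  assumes "e \<in> E" "T \<subseteq> X e"
  shows "\<Union>(set (cell e T)) = e \<union> T"
  using sub_X_D[OF assms(2)] by (intro Union_cell finite_edge assms) simp_all

lemma blocks_cell_X: "e \<in> E \<Longrightarrow> T \<subseteq> X e \<Longrightarrow> blocks (cell e T)"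
  by (intro blocks_cell finite_edge finite_sub_X)

lemma x_mon_edge_Un:
  assumes "e \<in> E" "T \<subseteq> X e"
  shows "x_mon (e \<union> T) = x_mon e + x_mon T"
  using finite_edge[OF assms(1)] finite_sub_X[OF assms(2)] disjoint_sub_X[OF assms(2)]
  by (intro x_mon_Un_disjoint) blast+

lemma mdeg_cell:
  assumes "e \<in> E" "T \<subseteq> X e"
  shows "mdeg (cell_complex E') (Some (cell e T)) = x_mon e + x_mon T"
  using blocks_cell_X[OF assms] Union_cell_X[OF assms] x_mon_edge_Un[OF assms]
  by (simp add: cell_complex_def cellular_complex_def reorient_def hom_complex_def blocks_x_mon)

lemma cell_dim_cell:
  assumes "e \<in> E" "T \<subseteq> X e"
  shows "cell_dim (cell e T) = card T"
proof -
  have "card (e \<union> T) = card e + card T"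
    using finite_edge[OF assms(1)] finite_sub_X[OF assms(2)] disjoint_sub_X[OF assms(2)]
    by (intro card_Un_disjoint) blast+
  then show ?thesis
    using blocks_card[OF blocks_cell_X[OF assms]] Union_cell_X[OF assms] by (simp add: cell_def)
qed

lemma bij_betw_cell_of:
  assumes "lex_initial E'"
  shows "bij_betw cell_of (cone_elements E' i) (basis (cell_complex E') i)"
proof (cases i)
  case 0
  then show ?thesis by (simp add: cone_elements_def basis_cell_complex bij_betw_def)
next
  case (Suc j)
  note sub = lex_initial_subset[OF assms]
  let ?P = "{(e, T). e \<in> E' \<and> T \<subseteq> X e \<and> card T = j}"
  have inj: "inj_on (\<lambda>(e, T). cell e T) ?P"
  proof (rule inj_onI, clarify)
    fix e T e' T' assume "cell e T = cell e' T'" and "e \<in> E'" "T \<subseteq> X e" "e' \<in> E'" "T' \<subseteq> X e'"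
    then show "e = e' \<and> T = T'"
      using sub finite_edge cell_inject[of e e' T T'] by blast
  qed
  have "(\<lambda>(e, T). cell e T) ` ?P = {\<sigma> \<in> hom_cells d n E'. cell_dim \<sigma> = j}"
  proof (intro equalityI subsetI)
    fix \<sigma> assume "\<sigma> \<in> (\<lambda>(e, T). cell e T) ` ?P"
    then obtain e T where "e \<in> E'" "T \<subseteq> X e" "card T = j" "\<sigma> = cell e T" by auto
    then show "\<sigma> \<in> {\<sigma> \<in> hom_cells d n E'. cell_dim \<sigma> = j}"
      using cell_in_hom_cells[OF assms, of e T] cell_dim_cell[of e T] sub by blast
  next
    fix \<sigma> assume \<sigma>: "\<sigma> \<in> {\<sigma> \<in> hom_cells d n E'. cell_dim \<sigma> = j}"
    then have \<sigma>': "\<sigma> \<in> hom_cells d n E'" by simp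
    obtain e T where eT: "e \<in> E'" "T \<subseteq> X e" "\<sigma> = cell e T"
      using hom_cell_is_cell[OF assms \<sigma>'] .
    moreover from this have "card T = j"
      using cell_dim_cell[OF subsetD[OF sub eT(1)] eT(2)] \<sigma> by (simp only: mem_Collect_eq)
    ultimately have "(e, T) \<in> ?P" "\<sigma> = (\<lambda>(e, T). cell e T) (e, T)" by simp_all
    then show "\<sigma> \<in> (\<lambda>(e, T). cell e T) ` ?P" by (rule rev_image_eqI)
  qed
  with inj have "bij_betw (\<lambda>(e, T). cell e T) ?P {\<sigma> \<in> hom_cells d n E'. cell_dim \<sigma> = j}"
    by (simp only: bij_betw_def)
  then have "bij_betw cell_of (Some ` ?P) (Some ` {\<sigma> \<in> hom_cells d n E'. cell_dim \<sigma> = j})"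
    unfolding cell_of_def by (rule bij_betw_map_option_Some)
  then show ?thesis
    by (simp only: Suc cone_elements_def basis_cell_complex nat.case)
qed

section \<open>Koszul signs of the cells of one edge\<close>

text \<open>A factor lies below \<open>t\<close> exactly when its maximum does, and the maxima are
  the vertices of \<open>e\<close>.\<close>

lemma card_blocks_below:
  assumes "finite e"
  shows "card {l. l < length (cell e T) \<and> (\<forall>y\<in>cell e T ! l. y < t)} = card {v \<in> e. v < t}"
proof -
  let ?l = "sorted_list_of_set e"
  have "(\<forall>y\<in>block e T v. y < t) \<longleftrightarrow> v < t" for v
    using block_le[of _ e T v] le_less_trans[of _ v t] by (auto simp: block_def)
  then have "{l. l < length (cell e T) \<and> (\<forall>y\<in>cell e T ! l. y < t)} = {l. l < length ?l \<and> ?l ! l < t}"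
    unfolding cell_def length_map by (intro Collect_cong conj_cong refl) simp
  moreover have "card \<dots> = length (filter (\<lambda>v. v < t) ?l)"
    by (simp only: length_filter_conv_card)
  moreover have "\<dots> = card (set (filter (\<lambda>v. v < t) ?l))"
    by (rule distinct_card[symmetric]) simp
  moreover have "set (filter (\<lambda>v. v < t) ?l) = {v \<in> e. v < t}"
    using assms by auto
  ultimately show ?thesis by simp
qed

text \<open>The vertices of \<open>e\<close> below \<open>t\<close> enter \<open>face_sign\<close>
  twice, once as vertices and once as factors, and cancel modulo 2.\<close>

lemma face_sign_cell:
  assumes "e \<in> E" "T \<subseteq> X e"
  shows "face_sign (cell e T) t = (-1) ^ card {s \<in> T. s < t}"
proof -
  note fin = finite_edge[OF assms(1)] and T = finite_sub_X[OF assms(2)] disjoint_sub_X[OF assms(2)]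
  have "{y \<in> e \<union> T. y < t} = {v \<in> e. v < t} \<union> {s \<in> T. s < t}" by blast
  moreover have "card \<dots> = card {v \<in> e. v < t} + card {s \<in> T. s < t}"
    using fin T by (intro card_Un_disjoint) auto
  ultimately show ?thesis
    unfolding face_sign_def card_blocks_below[OF fin] Union_cell_X[OF assms]
    by (simp add: power_add)
qed

lemma cell_del:
  assumes e: "e \<in> E" and T: "T \<subseteq> X e" and t: "t \<in> T"
  shows "cell e (T - {t}) = del t (cell e T)"
proof -
  have "t \<notin> e" using disjoint_sub_X[OF T] t by blast
  then have "block e (T - {t}) v = block e T v - {t}" if "v \<in> e" for v
    using that by (auto simp: block_def)
  then show ?thesis
    using finite_edge[OF e] by (simp add: cell_def del_def)
qed

lemma koszul_bd_eq_cell_bd: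
  assumes e: "e \<in> E" and T: "T \<subseteq> X e" "card T = Suc i" and T': "T' \<subseteq> X e" "card T' = i"
  shows "bd (koszul (X e)) T T' =
    - bd (cell_complex E :: (_, 'k::field) free_complex) (Some (cell e T)) (Some (cell e T'))"
proof -
  have finT: "finite T" using finite_sub_X[OF T(1)] .
  let ?inc = "product_incidence (cell e T) (cell e T')"
  have "bd (cell_complex E :: (_, 'k) free_complex) (Some (cell e T)) (Some (cell e T')) =
    Poly_Mapping.single (x_mon (e \<union> T) - x_mon (e \<union> T'))
      (of_int ((-1) ^ Suc i * (-1) ^ i * ?inc))"
    using cell_dim_cell[OF e T(1)] cell_dim_cell[OF e T'(1)] T(2) T'(2)
      Union_cell_X[OF e T(1)] Union_cell_X[OF e T'(1)] blocks_cell_X[OF e T(1)] blocks_cell_X[OF e T'(1)]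
    by (simp add: cell_complex_def cellular_complex_def reorient_def hom_complex_def blocks_x_mon)
  \<comment> \<open>Consecutive dimensions carry opposite orientation signs, whence the minus sign
    that the cone puts on the Koszul differential.\<close>
  also have "(-1) ^ Suc i * (-1) ^ i * ?inc = - ?inc"
    by (simp flip: power_mult_distrib)
  finally have bd: "bd (cell_complex E :: (_, 'k) free_complex) (Some (cell e T)) (Some (cell e T')) =
    - Poly_Mapping.single (x_mon (e \<union> T) - x_mon (e \<union> T')) (of_int ?inc)"
    by (simp add: single_uminus)
  show ?thesis
  proof (cases "\<exists>t\<in>T. T' = T - {t}")
    case True
    then obtain t where t: "t \<in> T" "T' = T - {t}" by blast
    have "T' = T - {s} \<longleftrightarrow> s = t" if "s \<in> T" for s
      using t that by blast
    then have "bd (koszul (X e)) T T' = (\<Sum>s\<in>T. if s = t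
        then (-1) ^ card {r \<in> T. r < s} * monomial (x_mon {s}) else 0 :: 'k poly)"
      unfolding koszul_def by (simp cong: sum.cong)
    also have "\<dots> = (-1) ^ card {r \<in> T. r < t} * monomial (x_mon {t})"
      using finT t(1) by simp
    also have "\<dots> = Poly_Mapping.single (x_mon {t}) ((-1) ^ card {r \<in> T. r < t})"
      by (cases "even (card {r \<in> T. r < t})") (simp_all add: monomial_def single_uminus)
    also have "(-1) ^ card {r \<in> T. r < t} = (of_int ?inc :: 'k)"
      using product_incidence_del[OF blocks_cell_X[OF e T(1)], of t] t
      by (simp add: cell_del[OF e T(1) t(1)] face_sign_cell[OF e T(1)] Union_cell_X[OF e T(1)])
    also have "x_mon {t} = x_mon (e \<union> T) - x_mon (e \<union> T')"
    proof -
      have "t \<notin> e" using disjoint_sub_X[OF T(1)] t(1) by blast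
      then have "e \<union> T = {t} \<union> (e \<union> T')" "{t} \<inter> (e \<union> T') = {}" using t by auto
      then have "x_mon (e \<union> T) = x_mon {t} + x_mon (e \<union> T')"
        using finite_edge[OF e] finite_sub_X[OF T'(1)] x_mon_Un_disjoint[of "{t}" "e \<union> T'"] by simp
      then show ?thesis by simp
    qed
    finally show ?thesis unfolding bd by simp
  next
    case False
    \<comment> \<open>Both cells contain \<open>e\<close>, which is disjoint from \<open>T\<close>
      and \<open>T'\<close>, so a face relation would delete an element \<open>x\<close> of
      \<open>T\<close> and force \<open>T' = T - {x}\<close>.\<close>
    have "?inc = 0"
    proof (rule ccontr)
      assume "?inc \<noteq> 0"
      then obtain x where x: "x \<in> \<Union>(set (cell e T))" "cell e T' = del x (cell e T)"
        using product_incidence_nonzero[OF blocks_cell_X[OF e T(1)]] by blast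
      then have "e \<union> T' = e \<union> T - {x}"
        using Union_cell_X[OF e T(1)] Union_cell_X[OF e T'(1)] Union_del by metis
      moreover have "T \<inter> e = {}" "T' \<inter> e = {}" using disjoint_sub_X T(1) T'(1) by blast+
      moreover have "x \<in> e \<union> T" using x(1) Union_cell_X[OF e T(1)] by simp
      ultimately have "x \<in> T" "T' = T - {x}" by blast+
      with False show False by blast
    qed
    moreover have "bd (koszul (X e)) T T' = (0 :: 'k poly)"
      using False by (auto simp: koszul_def intro!: sum.neutral)
    ultimately show ?thesis unfolding bd by simp
  qed
qed

section \<open>The colon ideal of a step\<close>

text \<open>By \<open>monomial_Idl_eq\<close> both ideals are described by supports. Multiplying by
  the generator adds \<open>e\<close> to each support, and \<open>exchange_set_iff\<close> matches
  the two conditions.\<close>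

lemma colon_edge_ideal:
  assumes e: "e \<in> E" and E': "E' = {f \<in> E. x_mon e < x_mon f}"
  shows "colon n (edge_ideal n E') (monomial (x_mon e)) = (var_ideal n (X e) :: 'k::field poly set)"
proof -
  have ed: "edge_ideal n E' = {p :: 'k poly. \<forall>m\<in>Poly_Mapping.keys p.
      Poly_Mapping.keys m \<subseteq> {1..n} \<and> (\<exists>f\<in>E'. f \<subseteq> Poly_Mapping.keys m)}"
    unfolding edge_ideal_def using finite_edge edge_subset E' by (intro monomial_Idl_eq) blast
  have "var_ideal n (X e) = Idl\<^bsub>polys n\<^esub> ((\<lambda>f. monomial (x_mon f) :: 'k poly) ` (\<lambda>s. {s}) ` X e)"
    by (simp only: var_ideal_def image_image)
  also have "\<dots> = {p. \<forall>m\<in>Poly_Mapping.keys p.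
      Poly_Mapping.keys m \<subseteq> {1..n} \<and> (\<exists>f\<in>(\<lambda>s. {s}) ` X e. f \<subseteq> Poly_Mapping.keys m)}"
    using X_subset[of e] by (intro monomial_Idl_eq) blast
  finally have var: "var_ideal n (X e) = {p :: 'k poly. \<forall>m\<in>Poly_Mapping.keys p.
      Poly_Mapping.keys m \<subseteq> {1..n} \<and> (\<exists>s\<in>X e. s \<in> Poly_Mapping.keys m)}"
    by simp
  have keys: "Poly_Mapping.keys (m + x_mon e) = Poly_Mapping.keys m \<union> e" for m
    using finite_edge[OF e] by (simp add: keys_plus_mon keys_x_mon)
  have iff: "(\<exists>f\<in>E'. f \<subseteq> K \<union> e) \<longleftrightarrow> (\<exists>s\<in>X e. s \<in> K)" for K
    using exchange_set_iff[OF e, of K] unfolding E' by blast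
  show ?thesis
    unfolding colon_def ed var using edge_subset[OF e]
    by (auto simp add: polys_def keys_mult_monomial keys iff simp del: atLeastAtMost_iff)
qed

text \<open>The earlier cells form a subcomplex, and by uniqueness of \<open>(e, T)\<close> a cell
  of \<open>e\<close> is not among them. This is the zero block from \<open>F\<close> to
  \<open>G[1]\<close> in the differential of the cone.\<close>

lemma product_incidence_later:
  assumes E': "lex_initial E'" and e: "e \<in> E" "e \<notin> E'" and e': "e' \<in> E'"
    and T: "T \<subseteq> X e" and T': "T' \<subseteq> X e'"
  shows "product_incidence (cell e' T') (cell e T) = 0"
proof (rule ccontr)
  assume "\<not> ?thesis"
  moreover have e'E: "e' \<in> E" using lex_initial_subset[OF E'] e' by blast
  ultimately obtain x where x: "cell e T = del x (cell e' T')"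
    using product_incidence_nonzero[OF blocks_cell_X[OF e'E T']] by blast
  have b: "blocks (cell e T)" using blocks_cell_X[OF e(1) T] .
  then have "\<forall>s\<in>set (cell e' T'). s - {x} \<noteq> {}"
    unfolding x by (auto simp: blocks_def del_def)
  then have "cell e T \<in> hom_cells d n E'"
    unfolding x using hom_cells_del[OF cell_in_hom_cells[OF E' e' T']] by blast
  then obtain f S where f: "f \<in> E'" "S \<subseteq> X f" "cell e T = cell f S"
    using hom_cell_is_cell[OF E'] by metis
  then have "e = f"
    using cell_inject[OF finite_edge[OF e(1)] _ T f(2,3)] finite_edge lex_initial_subset[OF E'] by blast
  with f e show False by blast
qed

section \<open>One step of the iteration\<close>

lemma cone_elements_insert:
  "cone_elements (insert e E') i = cone_elements E' i \<union>
     (case i of 0 \<Rightarrow> {} | Suc j \<Rightarrow> (\<lambda>T. Some (e, T)) ` {T. T \<subseteq> X e \<and> card T = j})"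
  by (cases i) (auto simp: cone_elements_def)

lemma basis_koszul: "basis (shift m (koszul (X e))) i = {T. T \<subseteq> X e \<and> card T = i}"
  using finite_subset[OF _ finite_X] by (auto simp: shift_def koszul_def)

lemma finite_cone_elements:
  assumes "E' \<subseteq> E"
  shows "finite (cone_elements E' i)"
proof (cases i)
  case (Suc j)
  have "{(e, T). e \<in> E' \<and> T \<subseteq> X e \<and> card T = j} \<subseteq> E \<times> Pow {1..n}"
    using assms X_subset by blast
  then have "finite {(e, T). e \<in> E' \<and> T \<subseteq> X e \<and> card T = j}"
    by (rule finite_subset) (simp add: finite_E)
  then show ?thesis by (simp add: Suc cone_elements_def)
qed (simp add: cone_elements_def)

text \<open>A subset \<open>T\<close> of Koszul degree \<open>i\<close> is a cell in degree
  \<open>Suc i\<close>, so this part of the boundary lands in degree \<open>i\<close> of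
  \<open>F\<close>, as a chain map must. The commutation rule is the entry of the squared
  differential from a new cell to an earlier one.\<close>

lemma chain_map_cell_bd:
  fixes F :: "(cone_basis, 'k::field) free_complex"
  assumes init: "lex_initial E'" "lex_initial (insert e E')" and e: "e \<in> E" "e \<notin> E'"
    and F: "cone_of_cells E' F"
  shows "chain_map n (shift (x_mon e) (koszul (X e))) F
    (\<lambda>T f. bd (cell_complex E) (Some (cell e T)) (cell_of f))"
  unfolding chain_map_def
proof (intro conjI allI ballI)
  let ?G = "shift (x_mon e) (koszul (X e)) :: (_, 'k) free_complex"
  let ?C = "cell_complex (insert e E') :: (_, 'k) free_complex"
  let ?bd = "bd (cell_complex E :: (_, 'k) free_complex)"
  have bF: "basis F i = cone_elements E' i" for i
    using F by (simp add: cone_of_cells_def)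
  have inC: "cell_of b \<in> basis ?C i" if "b \<in> cone_elements (insert e E') i" for b i
    using bij_betw_cell_of[OF init(2), of i] that by (meson bij_betwE)
  have T_in: "Some (e, T) \<in> cone_elements (insert e E') (Suc i)" if "T \<in> basis ?G i" for T i
    using that by (simp add: cone_elements_insert basis_koszul)
  have f_in: "f \<in> cone_elements (insert e E') i" if "f \<in> basis F i" for f i
    using that by (simp add: cone_elements_insert bF)
  have homog: "m + mdeg F f = mdeg ?G T"
    if T: "T \<in> basis ?G i" and f: "f \<in> basis F i" and m: "m \<in> Poly_Mapping.keys (?bd (Some (cell e T)) (cell_of f))"
    for i T f m
  proof -
    have "m + mdeg ?C (cell_of f) = mdeg ?C (Some (cell e T))"
    proof (rule cellular_complex_homogeneous[OF cell_complex_def])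
      show "Some (cell e T) \<in> basis ?C (Suc i)" using inC[OF T_in[OF T]] by simp
      show "cell_of f \<in> basis ?C i" using inC[OF f_in[OF f]] .
      show "m \<in> Poly_Mapping.keys (bd ?C (Some (cell e T)) (cell_of f))"
        using m unfolding cell_complex_cong(2)[of "insert e E'"] .
    qed
    moreover have "mdeg F f = mdeg ?C (cell_of f)"
      using F f unfolding cone_of_cells_def cell_complex_cong(1)[of "insert e E'"] by blast
    moreover have "T \<subseteq> X e" using T by (simp add: basis_koszul)
    then have "mdeg ?C (Some (cell e T)) = mdeg ?G T"
      by (simp add: mdeg_cell[OF e(1)] shift_def koszul_def)
    ultimately show ?thesis by simp
  qed
  fix i T f
  assume T: "T \<in> basis ?G i" and f: "f \<in> basis F i"
  show "?bd (Some (cell e T)) (cell_of f) \<in> carrier (polys n)"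
  proof -
    have "Poly_Mapping.keys m \<subseteq> {1..n}"
      if "m \<in> Poly_Mapping.keys (?bd (Some (cell e T)) (cell_of f))" for m
    proof -
      have TX: "T \<subseteq> X e" using T by (simp add: basis_koszul)
      \<comment> \<open>By homogeneity \<open>m\<close> divides the multidegree of \<open>T\<close>,
        which involves only variables of \<open>e\<close> and \<open>T\<close>.\<close>
      have "Poly_Mapping.keys m \<subseteq> Poly_Mapping.keys (mdeg ?G T)"
        unfolding homog[OF T f that, symmetric] keys_plus_mon by blast
      also have "mdeg ?G T = x_mon e + x_mon T" by (simp add: shift_def koszul_def)
      also have "Poly_Mapping.keys (x_mon e + x_mon T) = e \<union> T"
        using finite_edge[OF e(1)] finite_sub_X[OF TX] by (simp add: keys_plus_mon keys_x_mon)
      finally show ?thesis using edge_subset[OF e(1)] TX X_subset[of e] by blast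
    qed
    then show ?thesis by (simp add: polys_def)
  qed
  fix m assume "m \<in> Poly_Mapping.keys (?bd (Some (cell e T)) (cell_of f))"
  then show "m + mdeg F f = mdeg ?G T" by (rule homog[OF T f])
next
  let ?G = "shift (x_mon e) (koszul (X e)) :: (_, 'k) free_complex"
  let ?C = "cell_complex (insert e E') :: (_, 'k) free_complex"
  let ?bd = "bd (cell_complex E :: (_, 'k) free_complex)"
  fix i T f
  assume T: "T \<in> basis ?G (Suc i)" and f: "f \<in> basis F i"
  let ?g = "\<lambda>c. ?bd (Some (cell e T)) c * ?bd c (cell_of f)"
  have bF: "basis F i = cone_elements E' i" for i
    using F by (simp add: cone_of_cells_def)
  have TX: "T \<subseteq> X e" "card T = Suc i" using T by (simp_all add: basis_koszul)
  have inC: "cell_of b \<in> basis ?C j" if "b \<in> cone_elements (insert e E') j" for b j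
    using bij_betw_cell_of[OF init(2), of j] that by (meson bij_betwE)
  have "(\<Sum>c\<in>basis ?C (Suc i). bd ?C (Some (cell e T)) c * bd ?C c (cell_of f)) = 0"
  proof (rule cellular_complex_squared[OF cell_complex_def orientation_change_dim])
    show "Some (cell e T) \<in> basis ?C (Suc (Suc i))"
      using inC[of "Some (e, T)" "Suc (Suc i)"] TX by (simp add: cone_elements_insert)
    show "cell_of f \<in> basis ?C i"
      using inC[of f i] f by (simp add: cone_elements_insert bF)
  qed
  then have "0 = (\<Sum>c\<in>basis ?C (Suc i). ?g c)"
    unfolding cell_complex_cong(2)[of "insert e E'"] by simp
  also have "\<dots> = (\<Sum>b\<in>cone_elements (insert e E') (Suc i). ?g (cell_of b))"
    by (rule sum.reindex_bij_betw[OF bij_betw_cell_of[OF init(2)], symmetric])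
  \<comment> \<open>Earlier middle cells contribute the lift followed by the differential of
    \<open>F\<close>; new ones contribute minus the Koszul differential followed by the
    lift.\<close>
  also have "\<dots> = (\<Sum>b\<in>cone_elements E' (Suc i). ?g (cell_of b)) +
      (\<Sum>b\<in>(\<lambda>T. Some (e, T)) ` {T. T \<subseteq> X e \<and> card T = i}. ?g (cell_of b))"
    unfolding cone_elements_insert nat.case
  proof (rule sum.union_disjoint)
    show "finite (cone_elements E' (Suc i))"
      using finite_cone_elements[OF lex_initial_subset[OF init(1)]] .
    show "finite ((\<lambda>T. Some (e, T)) ` {T. T \<subseteq> X e \<and> card T = i})"
      using finite_X[of e] by simp
    show "cone_elements E' (Suc i) \<inter> (\<lambda>T. Some (e, T)) ` {T. T \<subseteq> X e \<and> card T = i} = {}"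
      using e(2) by (auto simp: cone_elements_def)
  qed
  also have "(\<Sum>b\<in>(\<lambda>T. Some (e, T)) ` {T. T \<subseteq> X e \<and> card T = i}. ?g (cell_of b)) =
      (\<Sum>T'\<in>basis ?G i. ?g (Some (cell e T')))"
    unfolding basis_koszul by (subst sum.reindex) (auto simp: inj_on_def)
  also have "\<dots> = - (\<Sum>T'\<in>basis ?G i. bd ?G T T' * ?bd (Some (cell e T')) (cell_of f))"
    unfolding sum_negf[symmetric]
  proof (rule sum.cong[OF refl])
    fix T' assume "T' \<in> basis ?G i"
    then have "T' \<subseteq> X e" "card T' = i" by (simp_all add: basis_koszul)
    from koszul_bd_eq_cell_bd[OF e(1) TX this]
    have "bd ?G T T' = - ?bd (Some (cell e T)) (Some (cell e T'))" by (simp add: shift_def)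
    then show "?g (Some (cell e T')) = - (bd ?G T T' * ?bd (Some (cell e T')) (cell_of f))"
      by simp
  qed
  also have "(\<Sum>b\<in>cone_elements E' (Suc i). ?g (cell_of b)) =
      (\<Sum>f'\<in>basis F (Suc i). ?bd (Some (cell e T)) (cell_of f') * bd F f' f)"
    unfolding bF[symmetric]
  proof (rule sum.cong[OF refl])
    fix f' assume "f' \<in> basis F (Suc i)"
    then have "bd F f' f = ?bd (cell_of f') (cell_of f)"
      using F f unfolding cone_of_cells_def by blast
    then show "?g (cell_of f') = ?bd (Some (cell e T)) (cell_of f') * bd F f' f" by simp
  qed
  finally show "(\<Sum>T'\<in>basis ?G i. bd ?G T T' * ?bd (Some (cell e T')) (cell_of f)) =
      (\<Sum>f'\<in>basis F (Suc i). ?bd (Some (cell e T)) (cell_of f') * bd F f' f)"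
    by (simp add: eq_neg_iff_add_eq_0)
qed

text \<open>The differential has four blocks. Between earlier elements the invariant of
  \<open>F\<close> applies, from earlier to new ones both sides vanish by
  \<open>product_incidence_later\<close>, between new ones the signed Koszul differential appears,
  and from new to earlier ones the lift was chosen to agree.\<close>

lemma cone_of_cells_step:
  fixes F :: "(cone_basis, 'k::field) free_complex"
  assumes init: "lex_initial E'" and e: "e \<in> E" "e \<notin> E'"
    and F: "cone_of_cells E' F"
  shows "cone_of_cells (insert e E') (relabel (untag e)
    (mapping_cone (shift (x_mon e) (koszul (X e))) F
      (\<lambda>T f. bd (cell_complex E) (Some (cell e T)) (cell_of f))))" (is "cone_of_cells _ ?F")
proof -
  let ?G = "shift (x_mon e) (koszul (X e)) :: (_, 'k) free_complex"
  let ?C = "cell_complex E :: (_, 'k) free_complex"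
  have bF: "basis F i = cone_elements E' i" for i
    using F by (simp add: cone_of_cells_def)
  \<comment> \<open>No earlier element carries the tag \<open>e\<close>, so \<open>untag e\<close>
    separates the two summands of the cone.\<close>
  have old: "e' \<noteq> e" if "Some (e', T) \<in> cone_elements E' i" for e' T i
    using that e(2) by (cases i) (auto simp: cone_elements_def)
  have untag_old: "untag e b = Inr b" if "b \<in> cone_elements E' i" for b i
    using that old by (cases b) (auto simp: untag_def)
  have untag_new: "untag e (Some (e, T)) = Inl T" for T
    by (simp add: untag_def)
  have bas: "basis ?F i = cone_elements (insert e E') i" for i
  proof (rule Set.set_eqI)
    fix b
    have "b \<in> basis ?F i \<longleftrightarrow>
        untag e b \<in> (case i of 0 \<Rightarrow> {} | Suc j \<Rightarrow> Inl ` basis ?G j) \<union> Inr ` cone_elements E' i"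
      by (simp add: relabel_def mapping_cone_def bF)
    also have "\<dots> \<longleftrightarrow> b \<in> cone_elements (insert e E') i"
    proof (cases "\<exists>T. b = Some (e, T)")
      case True
      then obtain T where "b = Some (e, T)" by blast
      then show ?thesis
        using old[of e T i] by (cases i) (auto simp: untag_new cone_elements_insert basis_koszul)
    next
      case False
      then have "untag e b = Inr b" by (auto simp: untag_def split: option.split)
      then show ?thesis
        using False by (cases i) (auto simp: cone_elements_insert)
    qed
    finally show "b \<in> basis ?F i \<longleftrightarrow> b \<in> cone_elements (insert e E') i" .
  qed
  have cases: "thesis"
    if "b \<in> cone_elements (insert e E') i" "b \<in> cone_elements E' i \<Longrightarrow> thesis"
      "\<And>T j. b = Some (e, T) \<Longrightarrow> i = Suc j \<Longrightarrow> T \<subseteq> X e \<Longrightarrow> card T = j \<Longrightarrow> thesis" for b i thesis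
    using that by (cases i) (auto simp: cone_elements_insert)
  have "mdeg ?F b = mdeg ?C (cell_of b)" if "b \<in> cone_elements (insert e E') i" for b i
    using that
  proof (rule cases)
    assume "b \<in> cone_elements E' i"
    then show ?thesis
      using F untag_old bF by (auto simp: relabel_def mapping_cone_def cone_of_cells_def)
  next
    fix T assume "b = Some (e, T)" "T \<subseteq> X e"
    then show ?thesis
      by (simp add: mdeg_cell[OF e(1)] relabel_def mapping_cone_def untag_new shift_def koszul_def)
  qed
  moreover have "bd ?F b b' = bd ?C (cell_of b) (cell_of b')"
    if b: "b \<in> cone_elements (insert e E') (Suc i)" and b': "b' \<in> cone_elements (insert e E') i" for b b' i
    using b
  proof (rule cases)
    assume bold: "b \<in> cone_elements E' (Suc i)"
    show ?thesis
      using b'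
    proof (rule cases)
      assume "b' \<in> cone_elements E' i"
      then show ?thesis
        using F bold untag_old bF by (auto simp: relabel_def mapping_cone_def cone_of_cells_def)
    next
      fix T' j assume T': "b' = Some (e, T')" "T' \<subseteq> X e"
      obtain e' T where eT: "b = Some (e', T)" "e' \<in> E'" "T \<subseteq> X e'"
        using bold by (auto simp: cone_elements_def)
      have "bd ?C (cell_of b) (cell_of b') = 0"
        using product_incidence_later[OF init e eT(2) T'(2) eT(3)]
        by (simp add: eT(1) T'(1) cell_complex_def cellular_complex_def reorient_def hom_complex_def)
      then show ?thesis
        using untag_old[OF bold] by (simp add: relabel_def mapping_cone_def T'(1) untag_new)
    qed
  next
    fix T j assume T: "b = Some (e, T)" "Suc i = Suc j" "T \<subseteq> X e" "card T = j"
    show ?thesis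
      using b'
    proof (rule cases)
      assume "b' \<in> cone_elements E' i"
      then show ?thesis
        using untag_old by (simp add: relabel_def mapping_cone_def T(1) untag_new)
    next
      fix T' k assume "b' = Some (e, T')" "i = Suc k" "T' \<subseteq> X e" "card T' = k"
      then show ?thesis
        using koszul_bd_eq_cell_bd[OF e(1) T(3), of k T', where 'k='k] T
        by (simp add: relabel_def mapping_cone_def untag_new shift_def)
    qed
  qed
  ultimately show ?thesis by (simp add: cone_of_cells_def bas)
qed

section \<open>Induction along the lexicographic list\<close>

text \<open>The induction splits off the generator attached last. Being initial forces the prefix
  before \<open>e\<close> to contain all edges lexicographically larger than \<open>e\<close>, so it
  is the edge set in \<open>colon_edge_ideal\<close>.\<close>

lemma iterated_cone_of_cells:
  assumes "sorted_wrt (\<lambda>e f. x_mon e > x_mon f) es" "lex_initial (set es)"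
  shows "\<exists>F :: (cone_basis, 'k::field) free_complex. iterated_cone n es F \<and> cone_of_cells (set es) F"
  using assms
proof (induction es rule: rev_induct)
  case Nil
  have bas: "cone_elements {} i = (if i = 0 then {None} else {})" for i
    by (cases i) (simp_all add: cone_elements_def)
  have "cone_of_cells {} (ring_complex :: (_, 'k) free_complex)"
    by (auto simp: cone_of_cells_def ring_complex_def bas mdeg_cell_None split: if_splits)
  then show ?case using iterated_cone.Nil by (metis list.set(1))
next
  case (snoc e es)
  have later: "x_mon e < x_mon f" if "f \<in> set es" for f
    using snoc.prems(1) that by (auto simp: sorted_wrt_append)
  have eE: "e \<in> E" using snoc.prems(2) by (simp add: lex_initial_def)
  have e: "e \<notin> set es" using later by blast
  have set_es: "set es = {f \<in> E. x_mon e < x_mon f}"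
  proof (intro equalityI subsetI)
    fix f assume "f \<in> set es"
    then show "f \<in> {f \<in> E. x_mon e < x_mon f}"
      using later snoc.prems(2) by (auto simp: lex_initial_def)
  next
    fix f assume "f \<in> {f \<in> E. x_mon e < x_mon f}"
    then have "f \<in> set (es @ [e])" "f \<noteq> e"
      using snoc.prems(2) by (auto simp: lex_initial_def)
    then show "f \<in> set es" by simp
  qed
  have init: "lex_initial (set es)"
    unfolding set_es lex_initial_def by auto
  have init': "lex_initial (insert e (set es))" using snoc.prems(2) by simp
  obtain F :: "(cone_basis, 'k) free_complex" where F: "iterated_cone n es F" "cone_of_cells (set es) F"
    using snoc.IH[OF _ init] snoc.prems(1) by (auto simp: sorted_wrt_append)
  let ?\<psi> = "\<lambda>T f. bd (cell_complex E :: (_, 'k) free_complex) (Some (cell e T)) (cell_of f)"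
  \<comment> \<open>The Koszul generator \<open>{}\<close> is the vertex \<open>e\<close>, and its
    boundary is the augmentation with the label as coefficient. So the lift sends it to this very
    monomial, not only modulo the ideal.\<close>
  have "?\<psi> {} None = monomial (mdeg (cell_complex E :: (_, 'k) free_complex) (Some (cell e {})))"
    by (simp add: cell_complex_def cellular_complex_def)
  then have \<psi>0: "?\<psi> {} None = monomial (x_mon e)"
    by (simp add: mdeg_cell[OF eE])
  have "iterated_cone n (es @ [e]) (relabel (untag e) (mapping_cone (shift (x_mon e) (koszul (X e))) F ?\<psi>))"
  proof (rule iterated_cone.snoc[OF F(1) X_subset colon_edge_ideal[OF eE set_es] refl
        chain_map_cell_bd[OF init init' eE e F(2)]])
    have "0 \<in> (edge_ideal n (set es) :: 'k poly set)"
      unfolding edge_ideal_def using finite_edge edge_subset lex_initial_subset[OF init]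
      by (subst monomial_Idl_eq) auto
    then show "?\<psi> {} None - monomial (x_mon e) \<in> edge_ideal n (set es)"
      by (simp only: \<psi>0 diff_self)
  qed
  moreover have "cone_of_cells (set (es @ [e]))
      (relabel (untag e) (mapping_cone (shift (x_mon e) (koszul (X e))) F ?\<psi>))"
    using cone_of_cells_step[OF init eE e F(2)] by simp
  ultimately show ?case by blast
qed

text \<open>Exponent vectors are linearly ordered, so they are sorted in place of the edges; the
  support of a squarefree monomial returns its edge.\<close>

lemma lex_list_exists: "\<exists>es. lex_list E es"
proof
  let ?l = "rev (sorted_list_of_set (x_mon ` E))"
  have keys: "Poly_Mapping.keys m \<in> E \<and> x_mon (Poly_Mapping.keys m) = m" if "m \<in> x_mon ` E" for m
    using that finite_edge keys_x_mon by auto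
  have set_l: "set ?l = x_mon ` E" using finite_E by simp
  have "sorted_wrt (\<lambda>a b. b < a) ?l" by (simp add: sorted_wrt_rev)
  then have "sorted_wrt (\<lambda>a b. x_mon (Poly_Mapping.keys b) < x_mon (Poly_Mapping.keys a)) ?l"
    by (rule sorted_wrt_mono_rel[rotated]) (use keys set_l in simp)
  moreover have "Poly_Mapping.keys ` x_mon ` E = E"
    using finite_edge keys_x_mon by (force simp: image_image)
  ultimately show "lex_list E (map Poly_Mapping.keys ?l)"
    using set_l by (simp add: lex_list_def sorted_wrt_map)
qed

end

theorem theorem1p2:
  fixes d n :: nat and E :: "nat set set"
  assumes "d_graph d {1..n} E"
    and "cointerval d {1..n} E"
  shows "\<exists>F :: (cone_basis, 'k::field) free_complex.
    lex_iterated_mapping_cone n E F \<and> supported_on F (hom_complex d n E)"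
proof -
  interpret cointerval_graph d n E using assms by unfold_locales
  obtain es where es: "lex_list E es" using lex_list_exists by blast
  then have "set es = E" "sorted_wrt (\<lambda>e f. x_mon e > x_mon f) es"
    by (simp_all add: lex_list_def)
  \<comment> \<open>The full edge set is an initial segment of itself, so the invariant at the last
    stage already compares \<open>F\<close> with the complex of all cells.\<close>
  then obtain F :: "(cone_basis, 'k) free_complex" where F: "iterated_cone n es F" "cone_of_cells E F"
    using iterated_cone_of_cells lex_initial_E by metis
  have "supported_on F (hom_complex d n E)"
    unfolding supported_on_def
  proof (intro exI conjI)
    show "orientation_change (hom_complex d n E) (\<lambda>\<sigma>. (-1) ^ cell_dim \<sigma>)"
      by (rule orientation_change_dim)
    show "let C = cellular_complex (reorient (\<lambda>\<sigma>. (-1) ^ cell_dim \<sigma>) (hom_complex d n E)) in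
       (\<forall>i. bij_betw cell_of (basis F i) (basis C i)) \<and>
       (\<forall>i. \<forall>b\<in>basis F i. mdeg F b = mdeg C (cell_of b)) \<and>
       (\<forall>i. \<forall>b\<in>basis F (Suc i). \<forall>b'\<in>basis F i. bd F b b' = bd C (cell_of b) (cell_of b'))"
      unfolding Let_def cell_complex_def[symmetric]
      using F(2) unfolding cone_of_cells_def by (simp add: bij_betw_cell_of[OF lex_initial_E])
  qed
  moreover have "lex_iterated_mapping_cone n E F"
    unfolding lex_iterated_mapping_cone_def using es F(1) by blast
  ultimately show ?thesis by blast
qed

end
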